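(* The regret of the Follow-the-Mean-then-$\rho$ algorithm satisfies: (1) if $\nu$ has a density bounded by some constant $M>0$, then for every $T\ge2$, $R_T\le\frac12+\frac M4\big(1+\ln(T-1)\big)$; (2) otherwise, for every time horizon $T\in\mathbb N$, $R_T\le 7.5+6\big(2\sqrt\pi+\sqrt2\big)\sqrt{T-1}$.
   Context: Brokerage setting: for $p,v_1,v_2\in[0,1]$ let $\mathrm{gft}(p,v_1,v_2):=(v_1\vee v_2-v_1\wedge v_2)\,\mathbb I\{v_1\wedge v_2\le p\le v_1\vee v_2\}$ ($\vee,\wedge$ = max, min). Valuations $V_1,V_2,\dots$ are i.i.d. with law $\nu$ on $[0,1]$; at round $t$ the learner posts $P_t\in[0,1]$, obtains $\mathrm{GFT}_t(P_t)$ with $\mathrm{GFT}_t(q):=\mathrm{gft}(q,V_{2t-1},V_{2t})$, and (full feedback) observes $V_{2t-1},V_{2t}$. Regret: $R_T:=\sup_{p}\mathbb E[\sum_{t=1}^T\mathrm{GFT}_t(p)]-\mathbb E[\sum_{t=1}^T\mathrm{GFT}_t(P_t)]$. For a probability measure $\mu$ on $[0,1]$ let $\bar\mu:=\int x\,\mathrm d\mu(x)$, $\tilde\rho(\mu)(p):=\int_0^p(\mu[0,\lambda]+\mu[0,\lambda))\,\mathrm d\lambda+(\mu[0,p]+\mu[0,p))(\bar\mu-p)$, $\rho(\mu)(p):=\tilde\rho(\mu)(p)+\mu\{p\}\big(\int_0^p\mu[0,\lambda]\,\mathrm d\lambda+\int_p^1\mu[\lambda,1]\,\mathrm d\lambda\big)$.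 FTM prices: $P'_1:=1/2$, $P'_t:=\frac1{2(t-1)}\sum_{s=1}^{2(t-1)}V_s$ for $t\ge2$. FT$\rho$ prices: $P''_1:=1/2$, and for $t\ge2$, $P''_t\in\arg\max_{p\in[0,1]}\rho(\hat\nu_t)(p)$ with $\hat\nu_t:=\frac1{2(t-1)}\sum_{s=1}^{2(t-1)}\delta_{V_s}$. The Follow-the-Mean-then-$\rho$ (FTMT$\rho$) algorithm: let $\tau$ be the first round $t$ such that $\{V_{2t-1},V_{2t}\}\cap\{V_1,\dots,V_{2(t-1)}\}\neq\varnothing$ ($\tau=\infty$ if no such round); it posts $P_t:=P'_t$ for $t\le\tau$ and $P_t:=P''_t$ for $t>\tau$. "Density bounded by $M$" means absolutely continuous w.r.t. Lebesgue with density $f\le M$. *)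

theory Defs
  imports "HOL-Probability.Probability"
begin

definition gft :: "real \<Rightarrow> real \<Rightarrow> real \<Rightarrow> real" where
  "gft p v1 v2 = (max v1 v2 - min v1 v2) *
     (if min v1 v2 \<le> p \<and> p \<le> max v1 v2 then 1 else 0)"

text \<open>Valuations: a sample path is \<open>\<omega> :: nat \<Rightarrow> real\<close>, with \<open>V_s = \<omega> (s - 1)\<close> for \<open>s \<ge> 1\<close>.\<close>
definition V :: "(nat \<Rightarrow> real) \<Rightarrow> nat \<Rightarrow> real" where
  "V \<omega> s = \<omega> (s - 1)"

definition GFT :: "(nat \<Rightarrow> real) \<Rightarrow> nat \<Rightarrow> real \<Rightarrow> real" where
  "GFT \<omega> t q = gft q (V \<omega> (2*t - 1)) (V \<omega> (2*t))"

definition Omega :: "real measure \<Rightarrow> (nat \<Rightarrow> real) measure" where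
  "Omega \<nu> = (\<Pi>\<^sub>M i\<in>(UNIV::nat set). \<nu>)"

definition mean :: "real measure \<Rightarrow> real" where
  "mean \<mu> = (\<integral>x. x \<partial>\<mu>)"

definition rho_tilde :: "real measure \<Rightarrow> real \<Rightarrow> real" where
  "rho_tilde \<mu> p =
     (\<integral>l\<in>{0..p}. (measure \<mu> {0..l} + measure \<mu> {0..<l}) \<partial>lborel)
     + (measure \<mu> {0..p} + measure \<mu> {0..<p}) * (mean \<mu> - p)"

definition rho :: "real measure \<Rightarrow> real \<Rightarrow> real" where
  "rho \<mu> p = rho_tilde \<mu> p + measure \<mu> {p} *
     ((\<integral>l\<in>{0..p}. measure \<mu> {0..l} \<partial>lborel) + (\<integral>l\<in>{p..1}. measure \<mu> {l..1} \<partial>lborel))"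

definition emp :: "real list \<Rightarrow> real measure" where
  "emp xs = measure_pmf (pmf_of_multiset (mset xs))"

definition P_FTM :: "(nat \<Rightarrow> real) \<Rightarrow> nat \<Rightarrow> real" where
  "P_FTM \<omega> t = (if t \<le> 1 then 1/2
     else (\<Sum>s=1..2*(t-1). V \<omega> s) / (2 * (real t - 1)))"

text \<open>Follow-the-\<open>\<rho>\<close> prices, with \<open>sel\<close> a selection of a maximiser of \<open>\<rho>(\<hat>\<nu>_t)\<close>.\<close>
definition P_FTrho :: "(real list \<Rightarrow> real) \<Rightarrow> (nat \<Rightarrow> real) \<Rightarrow> nat \<Rightarrow> real" where
  "P_FTrho sel \<omega> t = (if t \<le> 1 then 1/2 else sel (map (V \<omega>) [1..<2*(t-1)+1]))"

definition collision :: "(nat \<Rightarrow> real) \<Rightarrow> nat \<Rightarrow> bool" where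
  "collision \<omega> t \<longleftrightarrow> {V \<omega> (2*t-1), V \<omega> (2*t)} \<inter> V \<omega> ` {1..2*(t-1)} \<noteq> {}"

definition tau :: "(nat \<Rightarrow> real) \<Rightarrow> enat" where
  "tau \<omega> = (if \<exists>t\<ge>1. collision \<omega> t then enat (LEAST t. t \<ge> 1 \<and> collision \<omega> t) else \<infinity>)"

definition P_FTMTrho :: "(real list \<Rightarrow> real) \<Rightarrow> (nat \<Rightarrow> real) \<Rightarrow> nat \<Rightarrow> real" where
  "P_FTMTrho sel \<omega> t = (if enat t \<le> tau \<omega> then P_FTM \<omega> t else P_FTrho sel \<omega> t)"

definition regret :: "real measure \<Rightarrow> (real list \<Rightarrow> real) \<Rightarrow> nat \<Rightarrow> real" where
  "regret \<nu> sel T =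
     (SUP p\<in>{0..1}. \<integral>\<omega>. (\<Sum>t=1..T. GFT \<omega> t p) \<partial>Omega \<nu>)
     - (\<integral>\<omega>. (\<Sum>t=1..T. GFT \<omega> t (P_FTMTrho sel \<omega> t)) \<partial>Omega \<nu>)"

definition density_bounded_by :: "real measure \<Rightarrow> real \<Rightarrow> bool" where
  "density_bounded_by \<nu> M \<longleftrightarrow>
     (\<exists>f. f \<in> borel_measurable borel \<and> (\<forall>x. 0 \<le> f x \<and> f x \<le> M)
          \<and> \<nu> = density lborel (\<lambda>x. ennreal (f x)))"

end

theory Submission
  imports Defs
begin

text \<open>
  Up to the collision round the learner posts the sample mean \<open>p\<close>. Writing \<open>m\<close> for the mean of \<open>\<nu>\<close>,
  the expected gain of a price \<open>q\<close> exceeds that of \<open>p\<close> by at most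
  \<open>2 \<nu>{q} + 2 \<bar>m - p\<bar> \<nu>(between m and p)\<close>. With a density bounded by \<open>M\<close> this is at most
  \<open>2 M (m - p)\<^sup>2\<close>, which sums to a logarithm, and no collision occurs. In general, an atom \<open>q\<close> is drawn
  as first valuation of a round at most twice up to the collision, so that its mass times the expected
  number of these rounds is at most 2.

  After the collision the price maximises the empirical expected gain, since \<open>\<rho>\<close> of an empirical
  measure averages \<open>gft\<close> over all pairs of sample points. That price is compared with a ghost
  sample, the next \<open>n\<close> valuations of the same path. The empirical gains differ by at most four times
  the distance between the two empirical distribution functions, and exchangeability turns its
  expectation into that of the maximum of a Rademacher walk, controlled by Doob's \<open>L\<^sup>2\<close> inequality.
\<close>

text \<open>The mean is a good price by convexity. With \<open>B p\<close> the expectation of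
  \<open>max 0 (p - x)\<close> for one valuation \<open>x\<close>, the expected gain of
  \<open>p\<close> is, up to an atom term at \<open>p\<close>, twice the value at the mean of a
  supporting line of the convex function \<open>B\<close> at \<open>p\<close>. Such lines stay below
  \<open>B\<close>, and the one taken at the mean touches \<open>B\<close> there.

  In the general case the obstacle is dependence: the valuations that decide whether the algorithm
  has switched also determine the price it switches to. Nothing is conditioned on the collision. The
  error of the sample mean and the shortfall of the maximiser from the supremum of the expected gain
  are both nonnegative almost surely, so they can be added up in every round and integrated
  separately over the whole space; only the atom term is restricted to the rounds up to the
  collision.

  The maximiser also looks too good on the sample it was fitted to. The ghost sample is independent
  of it, and pairs of equal indices gain 0, so its expected empirical gain there is exactly
  \<open>1 - 1 / n\<close> times its expected gain.\<close>

text \<open>For \<open>x \<le> p \<le> y\<close> the gain \<open>y - x\<close> splits at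
  \<open>p\<close> into \<open>(y - p) + (p - x)\<close>. Every summand is a function of
  \<open>x\<close> times a function of \<open>y\<close>, so averages over pairs factor into
  one-variable averages.\<close>

lemma gft_decomp:
  "gft p x y = of_bool (x \<le> p) * max 0 (y - p) + of_bool (p \<le> y) * max 0 (p - x)
             + of_bool (y \<le> p) * max 0 (x - p) + of_bool (p \<le> x) * max 0 (p - y)"
  by (auto simp: gft_def max_def min_def)

lemma gft_nonneg: "0 \<le> gft p x y"
  by (auto simp: gft_def)

lemma gft_le: "gft p x y \<le> \<bar>x - y\<bar>"
  by (auto simp: gft_def)

lemma gft_same [simp]: "gft p x x = 0"
  by (simp add: gft_def)

section \<open>A maximal inequality for Rademacher sums\<close>

text \<open>Rademacher signs are encoded by the set of indices with sign -1. Averages over signs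
  become finite sums over a power set, and the same sets later index the exchanges between sample
  and ghost sample.\<close>

definition flip_sign :: "'i set \<Rightarrow> 'i \<Rightarrow> real" where
  "flip_sign S i = (if i \<in> S then -1 else 1)"

lemma sum_Pow_insert:
  fixes g :: "'i set \<Rightarrow> 'a::comm_monoid_add"
  assumes "finite I" "j \<notin> I"
  shows "(\<Sum>S\<in>Pow (insert j I). g S) = (\<Sum>S\<in>Pow I. g S + g (insert j S))"
proof -
  have inj: "inj_on (insert j) (Pow I)"
    using assms(2) by (auto simp: inj_on_def)
  have "(\<Sum>S\<in>Pow (insert j I). g S) = (\<Sum>S\<in>Pow I. g S) + (\<Sum>S\<in>insert j ` Pow I. g S)"
    unfolding Pow_insert using assms by (intro sum.union_disjoint) auto
  then show ?thesis
    by (simp add: sum.reindex[OF inj] sum.distrib)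
qed

text \<open>\<open>u(s, m) = 2 m\<^sup>2 - 4 m \<bar>s\<bar>\<close> is the Burkholder function of Doob's \<open>L\<^sup>2\<close> inequality:
  it dominates \<open>m\<^sup>2 - 4 s\<^sup>2\<close> and decreases on average along a symmetric walk \<open>s\<close> with running
  maximum \<open>m\<close> of \<open>\<bar>s\<bar>\<close>.\<close>

lemma burkholder_step:
  fixes s m :: real
  assumes "\<bar>s\<bar> \<le> m"
  defines "u \<equiv> \<lambda>s m. 2 * m\<^sup>2 - 4 * m * \<bar>s\<bar>"
  shows "u (1 + s) (max m \<bar>1 + s\<bar>) + u (-1 + s) (max m \<bar>-1 + s\<bar>) \<le> 2 * u s m"
proof -
  \<comment> \<open>Updating the maximum does not increase \<open>u\<close>: for
    \<open>\<bar>r\<bar> > m\<close> the decrease is twice the square of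
    \<open>\<bar>r\<bar> - m\<close>.\<close>
  have *: "u r (max m \<bar>r\<bar>) \<le> u r m" for r
  proof -
    have "0 \<le> (\<bar>r\<bar> - m)\<^sup>2" by simp
    then show ?thesis
      by (auto simp: u_def max_def power2_eq_square algebra_simps)
  qed
  \<comment> \<open>Convexity of the absolute value; \<open>m\<close> is nonnegative because it
    dominates \<open>\<bar>s\<bar>\<close>.\<close>
  have "m * (2 * \<bar>s\<bar>) \<le> m * (\<bar>1 + s\<bar> + \<bar>-1 + s\<bar>)"
    using assms(1) by (intro mult_left_mono) auto
  then have "u (1 + s) m + u (-1 + s) m \<le> 2 * u s m"
    by (simp add: u_def algebra_simps)
  with *[of "1 + s"] *[of "-1 + s"] show ?thesis by linarith
qed

text \<open>Indices are inserted by increasing \<open>a\<close>. The new index \<open>j\<close> is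
  then largest, so a threshold sum over \<open>insert j I\<close> is either the full sum or a
  threshold sum over \<open>I\<close>: thresholds see only prefixes of a walk, and \<open>M\<close>
  is its running maximum. That \<open>M\<close> dominates the full sum is carried along because
  \<open>burkholder_step\<close> requires it.\<close>

lemma rademacher_maximal_potential:
  fixes a :: "'i \<Rightarrow> real"
  assumes "finite I"
  shows "\<exists>M. (\<forall>S\<in>Pow I. \<bar>\<Sum>i\<in>I. flip_sign S i\<bar> \<le> M S \<and>
               (\<forall>x. \<bar>\<Sum>i\<in>I. flip_sign S i * of_bool (a i \<le> x)\<bar> \<le> M S)) \<and>
             (\<Sum>S\<in>Pow I. 2 * (M S)\<^sup>2 - 4 * M S * \<bar>\<Sum>i\<in>I. flip_sign S i\<bar>) \<le> 0 \<and>
             (\<Sum>S\<in>Pow I. (\<Sum>i\<in>I. flip_sign S i)\<^sup>2) = card I * 2 ^ card I"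
  using assms
proof (induction I rule: finite_ranking_induct[where f = a])
  case empty
  show ?case by (intro exI[of _ "\<lambda>_. 0"]) auto
next
  case (insert j I)
  show ?case
  proof (cases "j \<in> I")
    case True
    then show ?thesis using insert.IH by (simp add: insert_absorb)
  next
    case False
    obtain M where M: "\<And>S. S \<subseteq> I \<Longrightarrow> \<bar>\<Sum>i\<in>I. flip_sign S i\<bar> \<le> M S"
       "\<And>S x. S \<subseteq> I \<Longrightarrow> \<bar>\<Sum>i\<in>I. flip_sign S i * of_bool (a i \<le> x)\<bar> \<le> M S"
       "(\<Sum>S\<in>Pow I. 2 * (M S)\<^sup>2 - 4 * M S * \<bar>\<Sum>i\<in>I. flip_sign S i\<bar>) \<le> 0"
       "(\<Sum>S\<in>Pow I. (\<Sum>i\<in>I. flip_sign S i)\<^sup>2) = card I * 2 ^ card I"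
      using insert.IH by auto
    define s where "s S = (\<Sum>i\<in>I. flip_sign S i)" for S
    define s' where "s' S = (\<Sum>i\<in>insert j I. flip_sign S i)" for S
    \<comment> \<open>The old maximum is known only on subsets of \<open>I\<close>, hence the
      removal of \<open>j\<close>; the sign of \<open>j\<close> enters through \<open>s'\<close>
      alone.\<close>
    define M' where "M' S = max (M (S - {j})) \<bar>s' S\<bar>" for S
    have del: "(\<Sum>i\<in>I. flip_sign S i * f i) = (\<Sum>i\<in>I. flip_sign (S - {j}) i * f i)"
      for S and f :: "'i \<Rightarrow> real"
      using False by (intro sum.cong) (auto simp: flip_sign_def)
    have s'1: "s' S = 1 + s S" if "S \<subseteq> I" for S
      using that False insert.hyps by (auto simp: s'_def s_def flip_sign_def)
    have s'2: "s' (insert j S) = - 1 + s S" if "S \<subseteq> I" for S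
    proof -
      have "insert j S - {j} = S" using that False by auto
      then have "(\<Sum>i\<in>I. flip_sign (insert j S) i) = s S"
        using del[of "insert j S" "\<lambda>_. 1"] by (simp add: s_def)
      then show ?thesis
        using False insert.hyps by (simp add: s'_def flip_sign_def)
    qed
    have sub: "S - {j} = S" if "S \<subseteq> I" for S
      using that False by auto
    have bound: "\<bar>\<Sum>i\<in>insert j I. flip_sign S i * of_bool (a i \<le> x)\<bar> \<le> M' S"
      if S: "S \<subseteq> insert j I" for S x
    proof (cases "a j \<le> x")
      case True
      then have "(\<Sum>i\<in>insert j I. flip_sign S i * of_bool (a i \<le> x)) = s' S"
        unfolding s'_def using insert.hyps by (intro sum.cong) (auto dest: order_trans)
      then show ?thesis by (simp add: M'_def)
    next
      case out: False
      have "(\<Sum>i\<in>insert j I. flip_sign S i * of_bool (a i \<le> x)) =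
        (\<Sum>i\<in>I. flip_sign (S - {j}) i * of_bool (a i \<le> x))"
        using out False insert.hyps del by simp
      also have "\<bar>\<dots>\<bar> \<le> M (S - {j})"
        using S by (intro M(2)) auto
      finally show ?thesis by (simp add: M'_def)
    qed
    have "(\<Sum>S\<in>Pow (insert j I). 2 * (M' S)\<^sup>2 - 4 * M' S * \<bar>s' S\<bar>) \<le>
      (\<Sum>S\<in>Pow I. 2 * (2 * (M S)\<^sup>2 - 4 * M S * \<bar>s S\<bar>))"
      (is "_ \<le> ?rhs")
      unfolding sum_Pow_insert[OF insert.hyps(1) False]
    proof (intro sum_mono)
      fix S assume "S \<in> Pow I"
      then have S: "S \<subseteq> I" by simp
      show "2 * (M' S)\<^sup>2 - 4 * M' S * \<bar>s' S\<bar> +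
         (2 * (M' (insert j S))\<^sup>2 - 4 * M' (insert j S) * \<bar>s' (insert j S)\<bar>)
         \<le> 2 * (2 * (M S)\<^sup>2 - 4 * M S * \<bar>s S\<bar>)"
        using burkholder_step[OF M(1)[OF S]] False
        by (simp add: M'_def s'1[OF S] s'2[OF S] sub[OF S] s_def[symmetric])
    qed
    also have "?rhs \<le> 0"
      unfolding sum_distrib_left[symmetric] using M(3) by (simp only: s_def)
    finally have doob: "(\<Sum>S\<in>Pow (insert j I). 2 * (M' S)\<^sup>2 - 4 * M' S * \<bar>s' S\<bar>) \<le> 0" .
    have "(\<Sum>S\<in>Pow (insert j I). (s' S)\<^sup>2) = (\<Sum>S\<in>Pow I. 2 * (s S)\<^sup>2 + 2)"
      unfolding sum_Pow_insert[OF insert.hyps(1) False]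
      by (intro sum.cong) (auto simp: s'1 s'2 power2_eq_square algebra_simps)
    also have "\<dots> = card (insert j I) * 2 ^ card (insert j I)"
      using M(4) False insert.hyps(1)
      by (simp add: s_def sum.distrib sum_distrib_left[symmetric] card_Pow algebra_simps)
    finally show ?thesis
      using bound doob by (intro exI[of _ M']) (auto simp: s'_def M'_def)
  qed
qed

lemma rademacher_maximal:
  fixes a :: "nat \<Rightarrow> real"
  shows "\<exists>M. (\<forall>S\<in>Pow {..<n}. \<forall>x. \<bar>\<Sum>i<n. flip_sign S i * of_bool (a i \<le> x)\<bar> \<le> M S) \<and>
             (\<Sum>S\<in>Pow {..<n}. M S) \<le> 2 ^ n * (2 * sqrt n)"
proof (cases "n = 0")
  case True
  then show ?thesis by (intro exI[of _ "\<lambda>_. 0"]) auto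
next
  case False
  define s where "s S = (\<Sum>i<n. flip_sign S i)" for S
  obtain M where M: "\<And>S x. S \<subseteq> {..<n} \<Longrightarrow> \<bar>\<Sum>i<n. flip_sign S i * of_bool (a i \<le> x)\<bar> \<le> M S"
     "(\<Sum>S\<in>Pow {..<n}. 2 * (M S)\<^sup>2 - 4 * M S * \<bar>s S\<bar>) \<le> 0"
     "(\<Sum>S\<in>Pow {..<n}. (s S)\<^sup>2) = n * 2 ^ n"
    using rademacher_maximal_potential[of "{..<n}" a] by (auto simp: s_def)
  define r where "r = sqrt n"
  have r: "r > 0" "r * r = n" using False by (auto simp: r_def)
  have "(\<Sum>S\<in>Pow {..<n}. (M S)\<^sup>2) \<le>
      (\<Sum>S\<in>Pow {..<n}. (2 * (M S)\<^sup>2 - 4 * M S * \<bar>s S\<bar>) + 4 * (s S)\<^sup>2)"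
  proof (intro sum_mono)
    fix S
    \<comment> \<open>This square is the difference of the two sides. Summed over all signs, the
      potential drops out and the second moment of \<open>M\<close> is at most four times that of
      the walk.\<close>
    have "0 \<le> (M S - 2 * \<bar>s S\<bar>)\<^sup>2" by simp
    then show "(M S)\<^sup>2 \<le> (2 * (M S)\<^sup>2 - 4 * M S * \<bar>s S\<bar>) + 4 * (s S)\<^sup>2"
      by (simp add: power2_diff power_mult_distrib algebra_simps)
  qed
  also have "\<dots> \<le> 4 * (n * 2 ^ n)"
    using M(2,3) by (simp add: sum.distrib sum_distrib_left[symmetric])
  finally have sq: "(\<Sum>S\<in>Pow {..<n}. (M S)\<^sup>2) \<le> 4 * (n * 2 ^ n)" .
  have "(\<Sum>S\<in>Pow {..<n}. M S) \<le> (\<Sum>S\<in>Pow {..<n}. (M S)\<^sup>2 / (4 * r) + r)"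
  proof (intro sum_mono)
    fix S
    \<comment> \<open>A linearised Cauchy-Schwarz inequality: the weight \<open>r = sqrt n\<close>
      makes it an equality at \<open>M S = 2 * r\<close>, the size given by the second moment
      bound.\<close>
    have "0 \<le> (M S - 2 * r)\<^sup>2" by simp
    then show "M S \<le> (M S)\<^sup>2 / (4 * r) + r"
      using r by (simp add: field_simps power2_eq_square)
  qed
  also have "\<dots> = (\<Sum>S\<in>Pow {..<n}. (M S)\<^sup>2) / (4 * r) + 2 ^ n * r"
    by (simp add: sum.distrib sum_divide_distrib card_Pow)
  also have "\<dots> \<le> 4 * (n * 2 ^ n) / (4 * r) + 2 ^ n * r"
    using sq r by (intro add_right_mono divide_right_mono) auto
  also have "\<dots> = 2 ^ n * (2 * sqrt n)"
    using r by (simp add: r_def[symmetric] field_simps)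
  finally show ?thesis using M(1) by (intro exI[of _ M]) auto
qed

section \<open>The empirical objective\<close>

definition avg :: "nat \<Rightarrow> (nat \<Rightarrow> real) \<Rightarrow> real" where
  "avg n f = (\<Sum>i<n. f i) / n"

lemma avg_mult: "avg n (\<lambda>i. avg n (\<lambda>j. f i * g j)) = avg n f * avg n g"
  by (simp add: avg_def sum_product sum_divide_distrib)

lemma avg_add: "avg n (\<lambda>i. f i + g i) = avg n f + avg n g"
  by (simp add: avg_def sum.distrib add_divide_distrib)

text \<open>The four products of \<open>gft_decomp\<close> average separately and agree in pairs
  when the two indices are exchanged, hence the factor 2. The sample enters only through two ramps
  and two tail frequencies.\<close>

lemma avg_gft:
  fixes x :: "nat \<Rightarrow> real"
  shows "avg n (\<lambda>i. avg n (\<lambda>j. gft p (x i) (x j))) =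
    2 * (avg n (\<lambda>i. max 0 (p - x i)) * avg n (\<lambda>i. of_bool (p \<le> x i))
       + avg n (\<lambda>i. max 0 (x i - p)) * avg n (\<lambda>i. of_bool (x i \<le> p)))"
  unfolding gft_decomp avg_add avg_mult
  using avg_mult[of n "\<lambda>i. max 0 (p - x i)" "\<lambda>i. of_bool (p \<le> x i)"]
    avg_mult[of n "\<lambda>i. max 0 (x i - p)" "\<lambda>i. of_bool (x i \<le> p)"]
  by (simp add: mult.commute)

text \<open>A ramp is the integral of a step. Both kinds of step occur because
  \<open>rho_tilde\<close> integrates the distribution function together with its left
  limit.\<close>

lemma integral_ramp:
  fixes x p :: real
  assumes "0 \<le> x" "0 \<le> p"
  shows "(\<integral>l\<in>{0..p}. of_bool (x \<le> l) \<partial>lborel) = max 0 (p - x)"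
    and "set_integrable lborel {0..p} (\<lambda>l. of_bool (x \<le> l) :: real)"
    and "(\<integral>l\<in>{0..p}. of_bool (x < l) \<partial>lborel) = max 0 (p - x)"
    and "set_integrable lborel {0..p} (\<lambda>l. of_bool (x < l) :: real)"
proof -
  have 1: "(\<lambda>l. indicat_real {0..p} l *\<^sub>R of_bool (x \<le> l)) = indicat_real {x..p}"
    and 2: "(\<lambda>l. indicat_real {0..p} l *\<^sub>R of_bool (x < l)) = indicat_real {x<..p}"
    using assms by (auto simp: fun_eq_iff indicator_def)
  show "(\<integral>l\<in>{0..p}. of_bool (x \<le> l) \<partial>lborel) = max 0 (p - x)"
    "set_integrable lborel {0..p} (\<lambda>l. of_bool (x \<le> l) :: real)"
    "(\<integral>l\<in>{0..p}. of_bool (x < l) \<partial>lborel) = max 0 (p - x)"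
    "set_integrable lborel {0..p} (\<lambda>l. of_bool (x < l) :: real)"
    unfolding set_lebesgue_integral_def set_integrable_def 1 2
    by (cases "x \<le> p"; simp add: emeasure_lborel_Icc_eq)+
qed

lemma integral_upper_ramp:
  fixes x p :: real
  assumes "x \<le> 1" "p \<le> 1"
  shows "(\<integral>l\<in>{p..1}. of_bool (l \<le> x) \<partial>lborel) = max 0 (x - p)"
    and "set_integrable lborel {p..1} (\<lambda>l. of_bool (l \<le> x) :: real)"
proof -
  have 1: "(\<lambda>l. indicat_real {p..1} l *\<^sub>R of_bool (l \<le> x)) = indicat_real {p..x}"
    using assms by (auto simp: fun_eq_iff indicator_def)
  show "(\<integral>l\<in>{p..1}. of_bool (l \<le> x) \<partial>lborel) = max 0 (x - p)"
    "set_integrable lborel {p..1} (\<lambda>l. of_bool (l \<le> x) :: real)"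
    unfolding set_lebesgue_integral_def set_integrable_def 1
    by (cases "p \<le> x"; simp add: emeasure_lborel_Icc_eq)+
qed

lemma set_integral_avg:
  assumes "\<And>i. i < n \<Longrightarrow> set_integrable M A (f i)"
  shows "(\<integral>l\<in>A. avg n (\<lambda>i. f i l) \<partial>M) = avg n (\<lambda>i. \<integral>l\<in>A. f i l \<partial>M)"
    and "set_integrable M A (\<lambda>l. avg n (\<lambda>i. f i l))"
proof -
  have *: "(\<lambda>l. indicat_real A l *\<^sub>R avg n (\<lambda>i. f i l)) =
    (\<lambda>l. (\<Sum>i<n. indicat_real A l *\<^sub>R f i l) / real n)"
    by (simp add: avg_def sum_distrib_left fun_eq_iff)
  have "(\<integral>l. (\<Sum>i<n. indicat_real A l *\<^sub>R f i l) / real n \<partial>M) =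
    (\<Sum>i<n. \<integral>l. indicat_real A l *\<^sub>R f i l \<partial>M) / real n"
    using assms unfolding set_integrable_def
    by (subst integral_divide_zero, subst Bochner_Integration.integral_sum) auto
  then show "(\<integral>l\<in>A. avg n (\<lambda>i. f i l) \<partial>M) = avg n (\<lambda>i. \<integral>l\<in>A. f i l \<partial>M)"
    unfolding set_lebesgue_integral_def * by (simp only: avg_def)
  show "set_integrable M A (\<lambda>l. avg n (\<lambda>i. f i l))"
    using assms unfolding set_integrable_def *
    by (intro integrable_divide_zero Bochner_Integration.integrable_sum) auto
qed

text \<open>The empirical measure is the image of the uniform law on positions, so repeated values
  keep their multiplicity.\<close>

lemma integral_emp:
  assumes "xs \<noteq> []"
  shows "(\<integral>x. f x \<partial>emp xs) = avg (length xs) (\<lambda>i. f (xs ! i))"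
proof -
  have "image_mset ((!) xs) (mset_set {..<length xs}) = mset xs"
    by (metis lessThan_atLeast0 map_nth mset_map mset_upt)
  then have "pmf_of_multiset (mset xs) = map_pmf ((!) xs) (pmf_of_set {..<length xs})"
    using assms by (subst map_pmf_of_set) auto
  then show ?thesis
    using assms by (simp add: emp_def integral_pmf_of_set[OF _ finite_lessThan] lessThan_empty_iff avg_def)
qed

lemma measure_emp:
  assumes "xs \<noteq> []"
  shows "measure (emp xs) B = avg (length xs) (\<lambda>i. of_bool (xs ! i \<in> B))"
  using integral_emp[OF assms, of "indicat_real B"]
  by (simp add: emp_def) (simp add: indicator_def of_bool_def)

text \<open>With ramps \<open>A\<close>, \<open>B\<close>, distribution function \<open>F\<close>
  and left limit \<open>F'\<close> at \<open>p\<close>, \<open>rho\<close> becomes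
  \<open>2 * A + (F + F') * (B - A) + (F - F') * (A + B)\<close>. The atom term cancels the mixed
  products and leaves \<open>2 * (A * (1 - F') + B * F)\<close>, the right-hand side of
  \<open>avg_gft\<close>.\<close>

lemma rho_emp:
  assumes xs: "xs \<noteq> []" "set xs \<subseteq> {0..1}" and p: "p \<in> {0..1}"
  shows "rho (emp xs) p =
    avg (length xs) (\<lambda>i. avg (length xs) (\<lambda>j. gft p (xs ! i) (xs ! j)))"
proof -
  define n where "n = length xs"
  define x where "x i = xs ! i" for i
  have n: "n > 0" using xs by (simp add: n_def)
  have x01: "0 \<le> x i" "x i \<le> 1" if "i < n" for i
    using xs(2) that nth_mem[of i xs] by (auto simp: n_def x_def simp del: nth_mem)
  define A where "A = avg n (\<lambda>i. max 0 (p - x i))"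
  define B where "B = avg n (\<lambda>i. max 0 (x i - p))"
  define F where "F = avg n (\<lambda>i. of_bool (x i \<le> p))"
  define F' where "F' = avg n (\<lambda>i. of_bool (x i < p))"
  define G where "G = avg n (\<lambda>i. of_bool (p \<le> x i))"
  have avg_cong: "avg n f = avg n g" if "\<And>i. i < n \<Longrightarrow> f i = g i" for f g
    using that by (simp add: avg_def)
  have m: "measure (emp xs) U = avg n (\<lambda>i. of_bool (x i \<in> U))" for U
    using measure_emp[OF xs(1)] by (simp add: n_def x_def)
  have F0: "measure (emp xs) {0..l} = avg n (\<lambda>i. of_bool (x i \<le> l))"
    "measure (emp xs) {0..<l} = avg n (\<lambda>i. of_bool (x i < l))"
    "measure (emp xs) {l..1} = avg n (\<lambda>i. of_bool (l \<le> x i))" for l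
    unfolding m by (auto intro!: avg_cong simp: x01)
  have mean: "mean (emp xs) - p = B - A"
    unfolding mean_def integral_emp[OF xs(1)] n_def[symmetric] x_def[symmetric]
  proof -
    have "B - A = (\<Sum>i<n. max 0 (x i - p) - max 0 (p - x i)) / n"
      by (simp add: B_def A_def avg_def sum_subtractf diff_divide_distrib)
    also have "\<dots> = (\<Sum>i<n. x i - p) / n"
      by (intro arg_cong2[where f = "(/)"] sum.cong) auto
    also have "\<dots> = avg n x - p"
      using n by (simp add: avg_def sum_subtractf field_simps)
    finally show "avg n x - p = B - A" by simp
  qed
  have atom: "measure (emp xs) {p} = F - F'"
  proof -
    have "F - F' = (\<Sum>i<n. of_bool (x i \<le> p) - of_bool (x i < p)) / n"
      by (simp add: F_def F'_def avg_def sum_subtractf diff_divide_distrib)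
    also have "\<dots> = avg n (\<lambda>i. of_bool (x i \<in> {p}))"
      unfolding avg_def by (intro arg_cong2[where f = "(/)"] sum.cong) auto
    finally show ?thesis by (simp add: m)
  qed
  have G: "G = 1 - F'"
  proof -
    have "G + F' = (\<Sum>i<n. of_bool (p \<le> x i) + of_bool (x i < p)) / n"
      by (simp add: G_def F'_def avg_def sum.distrib add_divide_distrib)
    also have "\<dots> = (\<Sum>i<n. 1) / n"
      by (intro arg_cong2[where f = "(/)"] sum.cong) auto
    finally show ?thesis using n by simp
  qed
  have "set_integrable lborel {0..p} (\<lambda>l. avg n (\<lambda>i. of_bool (x i \<le> l)))"
    "set_integrable lborel {0..p} (\<lambda>l. avg n (\<lambda>i. of_bool (x i < l)))"
    using p x01 by (auto intro!: set_integral_avg integral_ramp)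
  then have "(\<integral>l\<in>{0..p}. (measure (emp xs) {0..l} + measure (emp xs) {0..<l}) \<partial>lborel) =
     (\<integral>l\<in>{0..p}. avg n (\<lambda>i. of_bool (x i \<le> l)) \<partial>lborel) +
     (\<integral>l\<in>{0..p}. avg n (\<lambda>i. of_bool (x i < l)) \<partial>lborel)"
    unfolding F0 by (rule set_integral_add)
  also have "\<dots> = A + A"
  proof (intro arg_cong2[where f = "(+)"])
    show "(\<integral>l\<in>{0..p}. avg n (\<lambda>i. of_bool (x i \<le> l)) \<partial>lborel) = A"
      using p x01 by (subst set_integral_avg)
        (auto intro!: integral_ramp avg_cong simp: A_def)
    show "(\<integral>l\<in>{0..p}. avg n (\<lambda>i. of_bool (x i < l)) \<partial>lborel) = A"
      using p x01 by (subst set_integral_avg)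
        (auto intro!: integral_ramp avg_cong simp: A_def)
  qed
  finally have "rho_tilde (emp xs) p = A + A + (F + F') * (B - A)"
    unfolding rho_tilde_def mean F0 F_def F'_def by simp
  moreover have "(\<integral>l\<in>{0..p}. measure (emp xs) {0..l} \<partial>lborel) = A"
    unfolding F0 using p x01 by (subst set_integral_avg)
      (auto intro!: integral_ramp avg_cong simp: A_def)
  moreover have "(\<integral>l\<in>{p..1}. measure (emp xs) {l..1} \<partial>lborel) = B"
    unfolding F0 using p x01 by (subst set_integral_avg)
      (auto intro!: integral_upper_ramp avg_cong simp: B_def)
  ultimately have "rho (emp xs) p = A + A + (F + F') * (B - A) + (F - F') * (A + B)"
    by (simp add: rho_def atom)
  also have "\<dots> = 2 * (A * G + B * F)"
    by (simp add: G algebra_simps)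
  finally show ?thesis
    by (simp add: avg_gft n_def[symmetric] x_def[symmetric] A_def B_def F_def G_def)
qed

section \<open>Independent valuations\<close>

lemma gft_measurable [measurable (raw)]:
  assumes [measurable]: "f \<in> borel_measurable M" "g \<in> borel_measurable M" "h \<in> borel_measurable M"
  shows "(\<lambda>x. gft (f x) (g x) (h x)) \<in> borel_measurable M"
  unfolding gft_def by measurable

lemma gft_le_1: "x \<in> {0..1} \<Longrightarrow> y \<in> {0..1} \<Longrightarrow> gft p x y \<le> 1"
  by (rule order_trans[OF gft_le]) auto

locale iid_valuations =
  fixes \<nu> :: "real measure"
  assumes prob_space_law: "prob_space \<nu>"
    and sets_law [measurable_cong]: "sets \<nu> = sets borel"
    and law_unit_interval: "measure \<nu> {0..1} = 1"
begin

sublocale N: prob_space \<nu> by (rule prob_space_law)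

sublocale NN: pair_prob_space \<nu> \<nu> ..

sublocale W: sequence_space \<nu> ..

lemma space_law [simp]: "space \<nu> = UNIV"
  using sets_eq_imp_space_eq[OF sets_law] by simp

lemma measurable_law_eq [simp]: "measurable \<nu> M = measurable borel M"
  by (rule measurable_cong_sets[OF sets_law refl])

lemma prob_UNIV [simp]: "measure \<nu> UNIV = 1"
  using N.prob_space by simp

lemma space_Omega [simp]: "space (Omega \<nu>) = UNIV"
  by (simp add: Omega_def space_PiM)

sublocale O: prob_space "Omega \<nu>"
  unfolding Omega_def by (rule prob_space_PiM) (rule prob_space_law)

lemma prob_Omega_UNIV [simp]: "measure (Omega \<nu>) UNIV = 1"
  using O.prob_space by simp

lemma measurable_coordinate [measurable]: "(\<lambda>\<omega>. \<omega> i) \<in> borel_measurable (Omega \<nu>)"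
proof -
  have "(\<lambda>\<omega>. \<omega> i) \<in> measurable (Omega \<nu>) \<nu>"
    unfolding Omega_def by measurable
  then show ?thesis by (simp add: measurable_cong_sets[OF refl sets_law])
qed

lemma AE_law_unit: "AE x in \<nu>. x \<in> {0..1}"
  using law_unit_interval by (subst N.AE_in_set_eq_1) (auto simp: sets_law)

lemma distr_coordinate: "distr (Omega \<nu>) \<nu> (\<lambda>\<omega>. \<omega> i) = \<nu>"
  unfolding Omega_def by (rule W.PiM_component) simp

lemma AE_Omega_unit: "AE \<omega> in Omega \<nu>. \<forall>i. \<omega> i \<in> {0..1}"
proof (subst AE_all_countable, intro allI)
  fix i :: nat
  have "AE x in distr (Omega \<nu>) \<nu> (\<lambda>\<omega>. \<omega> i). x \<in> {0..1}"
    unfolding distr_coordinate by (rule AE_law_unit)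
  then show "AE \<omega> in Omega \<nu>. \<omega> i \<in> {0..1}"
    by (subst (asm) AE_distr_iff) simp_all
qed

lemma AE_pair_unit: "AE z in \<nu> \<Otimes>\<^sub>M \<nu>. fst z \<in> {0..1} \<and> snd z \<in> {0..1}"
proof (rule NN.AE_pair_measure)
  have "AE x in \<nu>. AE y in \<nu>. x \<in> {0..1} \<and> y \<in> {0..1}"
    using AE_law_unit by eventually_elim (use AE_law_unit in auto)
  then show "AE x in \<nu>. AE y in \<nu>. fst (x, y) \<in> {0..1} \<and> snd (x, y) \<in> {0..1}"
    by simp
qed measurable

lemma measurable_reindex:
  "(\<lambda>\<omega> i. \<omega> (f i)) \<in> measurable (Omega \<nu>) (Omega \<nu>)"
  unfolding Omega_def by (rule measurable_PiM_single') auto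

lemma distr_reindex:
  assumes "inj f"
  shows "distr (Omega \<nu>) (Omega \<nu>) (\<lambda>\<omega> i. \<omega> (f i)) = Omega \<nu>"
  using distr_PiM_reindex[of UNIV "\<lambda>_. \<nu>" f UNIV] assms prob_space_law
  by (simp add: Omega_def restrict_UNIV)

lemma integral_reindex:
  fixes h :: "(nat \<Rightarrow> real) \<Rightarrow> real"
  assumes "inj f" "h \<in> borel_measurable (Omega \<nu>)"
  shows "(\<integral>\<omega>. h (\<lambda>i. \<omega> (f i)) \<partial>Omega \<nu>) = (\<integral>\<omega>. h \<omega> \<partial>Omega \<nu>)"
  using integral_distr[OF measurable_reindex assms(2), of f] distr_reindex[OF assms(1)] by simp

lemma measurable_two_coordinates:
  "(\<lambda>\<omega>. (\<omega> i, \<omega> j)) \<in> measurable (Omega \<nu>) (\<nu> \<Otimes>\<^sub>M \<nu>)"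
  by measurable

lemma distr_two_coordinates:
  assumes "i \<noteq> j"
  shows "distr (Omega \<nu>) (\<nu> \<Otimes>\<^sub>M \<nu>) (\<lambda>\<omega>. (\<omega> i, \<omega> j)) = \<nu> \<Otimes>\<^sub>M \<nu>"
proof (rule pair_measure_eqI[symmetric])
  fix A B assume [measurable]: "A \<in> sets \<nu>" "B \<in> sets \<nu>"
  have "emeasure (distr (Omega \<nu>) (\<nu> \<Otimes>\<^sub>M \<nu>) (\<lambda>\<omega>. (\<omega> i, \<omega> j))) (A \<times> B) =
    emeasure (Omega \<nu>) {\<omega> \<in> space (Omega \<nu>). \<forall>k\<in>{i, j}. \<omega> k \<in> (if k = i then A else B)}"
    using assms by (subst emeasure_distr[OF measurable_two_coordinates])
      (auto intro!: arg_cong[where f = "emeasure (Omega \<nu>)"])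
  also have "\<dots> = (\<Prod>k\<in>{i, j}. emeasure \<nu> (if k = i then A else B))"
    unfolding Omega_def by (rule W.emeasure_PiM_Collect) auto
  finally show "emeasure \<nu> A * emeasure \<nu> B =
      emeasure (distr (Omega \<nu>) (\<nu> \<Otimes>\<^sub>M \<nu>) (\<lambda>\<omega>. (\<omega> i, \<omega> j))) (A \<times> B)"
    using assms by simp
qed (auto intro: N.sigma_finite_measure_axioms)

lemma integral_two_coordinates:
  fixes g :: "real \<times> real \<Rightarrow> real"
  assumes "i \<noteq> j" "g \<in> borel_measurable (\<nu> \<Otimes>\<^sub>M \<nu>)"
  shows "(\<integral>\<omega>. g (\<omega> i, \<omega> j) \<partial>Omega \<nu>) = (\<integral>z. g z \<partial>(\<nu> \<Otimes>\<^sub>M \<nu>))"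
  using integral_distr[OF measurable_two_coordinates assms(2), of i j]
    distr_two_coordinates[OF assms(1)] by simp

text \<open>Splicing the first \<open>n\<close> coordinates of one path with an independent second
  path preserves the law. After the splice, \<open>h\<close> reads its past from the first path and
  its two arguments from the second, and Fubini separates them.\<close>

lemma integral_fresh_pair:
  fixes h :: "(nat \<Rightarrow> real) \<Rightarrow> real \<Rightarrow> real \<Rightarrow> real"
  assumes ij: "i \<noteq> j" "n \<le> i" "n \<le> j"
    and past: "\<And>\<omega> \<omega>' x y. (\<And>k. k < n \<Longrightarrow> \<omega> k = \<omega>' k) \<Longrightarrow> h \<omega> x y = h \<omega>' x y"
    and meas: "\<And>\<omega>. (\<lambda>z. h \<omega> (fst z) (snd z)) \<in> borel_measurable (\<nu> \<Otimes>\<^sub>M \<nu>)"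
    and int: "integrable (Omega \<nu>) (\<lambda>\<omega>. h \<omega> (\<omega> i) (\<omega> j))"
  shows "(\<integral>\<omega>. h \<omega> (\<omega> i) (\<omega> j) \<partial>Omega \<nu>) =
      (\<integral>\<omega>. (\<integral>z. h \<omega> (fst z) (snd z) \<partial>(\<nu> \<Otimes>\<^sub>M \<nu>)) \<partial>Omega \<nu>)"
proof -
  interpret OO: pair_prob_space "Omega \<nu>" "Omega \<nu>" ..
  define H where "H \<omega> = h \<omega> (\<omega> i) (\<omega> j)" for \<omega>
  define c where "c = (\<lambda>(\<omega>, \<omega>'). comb_seq n \<omega> \<omega>' :: nat \<Rightarrow> real)"
  have [measurable]: "c \<in> measurable (Omega \<nu> \<Otimes>\<^sub>M Omega \<nu>) (Omega \<nu>)"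
    unfolding c_def Omega_def by (rule measurable_comb_seq)
  have dc: "distr (Omega \<nu> \<Otimes>\<^sub>M Omega \<nu>) (Omega \<nu>) c = Omega \<nu>"
    unfolding c_def Omega_def by (rule W.PiM_comb_seq)
  have [measurable]: "H \<in> borel_measurable (Omega \<nu>)"
    using int unfolding H_def by simp
  have intc: "integrable (Omega \<nu> \<Otimes>\<^sub>M Omega \<nu>) (\<lambda>z. H (c z))"
  proof (rule integrable_distr[where T = c and f = H and M' = "Omega \<nu>"])
    show "integrable (distr (Omega \<nu> \<Otimes>\<^sub>M Omega \<nu>) (Omega \<nu>) c) H"
      using int unfolding dc by (simp add: H_def [abs_def])
  qed measurable
  have inner: "(\<integral>\<omega>'. H (c (\<omega>, \<omega>')) \<partial>Omega \<nu>) = (\<integral>z. h \<omega> (fst z) (snd z) \<partial>(\<nu> \<Otimes>\<^sub>M \<nu>))" for \<omega>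
  proof -
    have "h (comb_seq n \<omega> \<omega>') x y = h \<omega> x y" for \<omega>' x y
      by (rule past) (simp add: comb_seq_less)
    then have "H (c (\<omega>, \<omega>')) = h \<omega> (\<omega>' (i - n)) (\<omega>' (j - n))" for \<omega>'
      using ij by (simp add: H_def c_def) (simp add: comb_seq_def)
    then show ?thesis
      using integral_two_coordinates[OF _ meas[of \<omega>], of "i - n" "j - n"] ij by simp
  qed
  have "(\<integral>\<omega>. H \<omega> \<partial>Omega \<nu>) = (\<integral>z. H (c z) \<partial>(Omega \<nu> \<Otimes>\<^sub>M Omega \<nu>))"
    by (subst dc[symmetric]) (simp add: integral_distr)
  also have "\<dots> = (\<integral>\<omega>. \<integral>\<omega>'. H (c (\<omega>, \<omega>')) \<partial>Omega \<nu> \<partial>Omega \<nu>)"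
    using OO.integral_fst'[OF intc] by simp
  finally show ?thesis unfolding inner by (simp add: H_def)
qed

definition expected_gft :: "real \<Rightarrow> real" where
  "expected_gft p = (\<integral>z. gft p (fst z) (snd z) \<partial>(\<nu> \<Otimes>\<^sub>M \<nu>))"

lemma integrable_pair_bounded:
  fixes g :: "real \<times> real \<Rightarrow> real"
  assumes "g \<in> borel_measurable (\<nu> \<Otimes>\<^sub>M \<nu>)"
    and "\<And>x y. x \<in> {0..1} \<Longrightarrow> y \<in> {0..1} \<Longrightarrow> \<bar>g (x, y)\<bar> \<le> C"
  shows "integrable (\<nu> \<Otimes>\<^sub>M \<nu>) g"
proof (rule NN.P.integrable_const_bound[where B = C])
  show "AE z in \<nu> \<Otimes>\<^sub>M \<nu>. norm (g z) \<le> C"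
    using AE_pair_unit by eventually_elim (use assms(2) in \<open>auto simp: split_beta\<close>)
qed fact

lemma integrable_law_bounded:
  fixes g :: "real \<Rightarrow> real"
  assumes "g \<in> borel_measurable borel" and "\<And>x. x \<in> {0..1} \<Longrightarrow> \<bar>g x\<bar> \<le> C"
  shows "integrable \<nu> g"
proof (rule N.integrable_const_bound[where B = C])
  show "AE x in \<nu>. norm (g x) \<le> C"
    using AE_law_unit by eventually_elim (use assms(2) in auto)
qed (use assms in \<open>simp add: measurable_cong_sets[OF sets_law refl]\<close>)

lemma integrable_Omega_bounded:
  fixes h :: "(nat \<Rightarrow> real) \<Rightarrow> real"
  assumes "h \<in> borel_measurable (Omega \<nu>)"
    and "\<And>\<omega>. (\<And>i. \<omega> i \<in> {0..1}) \<Longrightarrow> \<bar>h \<omega>\<bar> \<le> C"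
  shows "integrable (Omega \<nu>) h"
proof (rule O.integrable_const_bound[where B = C])
  show "AE \<omega> in Omega \<nu>. norm (h \<omega>) \<le> C"
    using AE_Omega_unit by eventually_elim (use assms(2) in auto)
qed fact

lemma integrable_gft: "integrable (\<nu> \<Otimes>\<^sub>M \<nu>) (\<lambda>z. gft p (fst z) (snd z))"
  by (rule integrable_pair_bounded[where C = 1]) (use gft_nonneg gft_le_1 in auto)

lemma expected_gft_measurable [measurable]: "expected_gft \<in> borel_measurable borel"
  unfolding expected_gft_def by measurable

lemma expected_gft_nonneg: "0 \<le> expected_gft p"
  unfolding expected_gft_def by (intro integral_nonneg_AE) (simp add: gft_nonneg)

lemma expected_gft_le_1: "expected_gft p \<le> 1"
  unfolding expected_gft_def
proof (rule NN.P.integral_le_const[OF integrable_gft])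
  show "AE z in \<nu> \<Otimes>\<^sub>M \<nu>. gft p (fst z) (snd z) \<le> 1"
    using AE_pair_unit by eventually_elim (auto intro!: gft_le_1)
qed

lemma integral_gft_coordinates:
  assumes "i \<noteq> j"
  shows "(\<integral>\<omega>. gft p (\<omega> i) (\<omega> j) \<partial>Omega \<nu>) = expected_gft p"
  using integral_two_coordinates[OF assms, of "\<lambda>z. gft p (fst z) (snd z)"]
  by (simp add: expected_gft_def)

lemma integrable_gft_price:
  assumes "P \<in> borel_measurable (Omega \<nu>)"
  shows "integrable (Omega \<nu>) (\<lambda>\<omega>. gft (P \<omega>) (\<omega> i) (\<omega> j))"
  using assms gft_nonneg gft_le_1
  by (intro integrable_Omega_bounded[where C = 1]) (auto simp del: atLeastAtMost_iff)

text \<open>Used for the posted price against the valuations of its own round, and for the empirical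
  maximiser against pairs of the ghost sample.\<close>

lemma integral_gft_price:
  assumes "i \<noteq> j" "n \<le> i" "n \<le> j"
    and [measurable]: "P \<in> borel_measurable (Omega \<nu>)"
    and past: "\<And>\<omega> \<omega>'. (\<And>k. k < n \<Longrightarrow> \<omega> k = \<omega>' k) \<Longrightarrow> P \<omega> = P \<omega>'"
  shows "(\<integral>\<omega>. gft (P \<omega>) (\<omega> i) (\<omega> j) \<partial>Omega \<nu>) = (\<integral>\<omega>. expected_gft (P \<omega>) \<partial>Omega \<nu>)"
  unfolding expected_gft_def
proof (rule integral_fresh_pair[where h = "\<lambda>\<omega> x y. gft (P \<omega>) x y", OF assms(1-3)])
  show "gft (P \<omega>) x y = gft (P \<omega>') x y" if "\<And>k. k < n \<Longrightarrow> \<omega> k = \<omega>' k" for \<omega> \<omega>' x y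
    using past[OF that] by simp
qed (simp_all add: integrable_gft_price)

lemma integral_pair_prod:
  fixes f g :: "real \<Rightarrow> real"
  assumes [measurable]: "f \<in> borel_measurable borel" "g \<in> borel_measurable borel"
    and bd: "\<And>x. x \<in> {0..1} \<Longrightarrow> \<bar>f x\<bar> \<le> C" "\<And>x. x \<in> {0..1} \<Longrightarrow> \<bar>g x\<bar> \<le> D"
  shows "(\<integral>z. f (fst z) * g (snd z) \<partial>(\<nu> \<Otimes>\<^sub>M \<nu>)) = (\<integral>x. f x \<partial>\<nu>) * (\<integral>x. g x \<partial>\<nu>)"
    and "integrable (\<nu> \<Otimes>\<^sub>M \<nu>) (\<lambda>z. f (fst z) * g (snd z))"
proof -
  show int: "integrable (\<nu> \<Otimes>\<^sub>M \<nu>) (\<lambda>z. f (fst z) * g (snd z))"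
  proof (rule integrable_pair_bounded[where C = "C * D"])
    fix x y :: real assume xy: "x \<in> {0..1}" "y \<in> {0..1}"
    have "\<bar>f x\<bar> * \<bar>g y\<bar> \<le> C * D"
      using bd(1)[OF xy(1)] bd(2)[OF xy(2)] by (intro mult_mono) auto
    then show "\<bar>f (fst (x, y)) * g (snd (x, y))\<bar> \<le> C * D" by (simp add: abs_mult)
  qed simp
  have "integrable \<nu> f" "integrable \<nu> g"
    by (rule integrable_law_bounded, simp, erule bd)+
  then show "(\<integral>z. f (fst z) * g (snd z) \<partial>(\<nu> \<Otimes>\<^sub>M \<nu>)) = (\<integral>x. f x \<partial>\<nu>) * (\<integral>x. g x \<partial>\<nu>)"
    using NN.integral_fst'[OF int] by simp
qed

end

lemma diff_square_le_quarter: "x - x\<^sup>2 \<le> 1 / (4::real)"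
  using zero_le_power2[of "x - 1/2"] by (simp add: power2_eq_square algebra_simps)

section \<open>Stability of the empirical objective in the empirical distribution function\<close>

lemma avg_mono: "(\<And>i. i < n \<Longrightarrow> f i \<le> g i) \<Longrightarrow> avg n f \<le> avg n g"
  unfolding avg_def by (intro divide_right_mono sum_mono) auto

lemma avg_const: "0 < n \<Longrightarrow> avg n (\<lambda>_. c) = c"
  by (simp add: avg_def)

text \<open>The ramps integrate over lengths \<open>p\<close> and \<open>1 - p\<close>, so they
  change by at most \<open>p * d\<close> and \<open>(1 - p) * d\<close>, and they are themselves at
  most \<open>p\<close> and \<open>1 - p\<close>. Each product then changes by at most
  \<open>2 * p * d\<close> or \<open>2 * (1 - p) * d\<close>; together this is \<open>2 * d\<close>,
  doubled by the factor in \<open>avg_gft\<close>. The strict hypothesis controls the upper tail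
  frequency, which is 1 minus a left limit.\<close>

lemma avg_gft_stable:
  fixes x y :: "nat \<Rightarrow> real"
  assumes n: "0 < n" and p: "p \<in> {0..1}"
    and xy: "\<And>i. i < n \<Longrightarrow> x i \<in> {0..1}" "\<And>i. i < n \<Longrightarrow> y i \<in> {0..1}"
    and le: "\<And>l. \<bar>avg n (\<lambda>i. of_bool (x i \<le> l)) - avg n (\<lambda>i. of_bool (y i \<le> l))\<bar> \<le> d"
    and less: "\<And>l. \<bar>avg n (\<lambda>i. of_bool (x i < l)) - avg n (\<lambda>i. of_bool (y i < l))\<bar> \<le> d"
  shows "avg n (\<lambda>i. avg n (\<lambda>j. gft p (x i) (x j)))
       \<le> avg n (\<lambda>i. avg n (\<lambda>j. gft p (y i) (y j))) + 4 * d"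
proof -
  define A where "A z = avg n (\<lambda>i. max 0 (p - z i))" for z :: "nat \<Rightarrow> real"
  define B where "B z = avg n (\<lambda>i. max 0 (z i - p))" for z :: "nat \<Rightarrow> real"
  define F where "F z l = avg n (\<lambda>i. of_bool (z i \<le> l))" for z :: "nat \<Rightarrow> real" and l
  define G where "G z l = avg n (\<lambda>i. of_bool (l \<le> z i))" for z :: "nat \<Rightarrow> real" and l
  have d: "0 \<le> d" using le[of 0] by linarith
  have avg_cong: "avg n f = avg n g" if "\<And>i. i < n \<Longrightarrow> f i = g i" for f g
    using that by (simp add: avg_def)
  have F: "F x l \<le> F y l + d" for l
    using le[of l] unfolding F_def by linarith
  have G_eq: "G z l = 1 - avg n (\<lambda>i. of_bool (z i < l))" for z l
  proof -
    have "G z l + avg n (\<lambda>i. of_bool (z i < l)) = avg n (\<lambda>_. 1)"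
      unfolding G_def avg_add[symmetric] by (intro avg_cong) auto
    then show ?thesis using n by (simp add: avg_const)
  qed
  have G: "G x l \<le> G y l + d" for l
    using less[of l] unfolding G_eq by linarith
  have unit: "avg n f \<le> c" if "\<And>i. i < n \<Longrightarrow> f i \<le> c" for f c
    using avg_mono[of n f "\<lambda>_. c"] that n by (auto simp: avg_const)
  have nonneg: "0 \<le> avg n f" if "\<And>i. i < n \<Longrightarrow> 0 \<le> f i" for f
    using avg_mono[of n "\<lambda>_. 0" f] that n by (simp add: avg_const)
  have A_int: "A z = (\<integral>l\<in>{0..p}. F z l \<partial>lborel)" "set_integrable lborel {0..p} (F z)"
    if z: "\<And>i. i < n \<Longrightarrow> z i \<in> {0..1}" for z
  proof -
    have i: "set_integrable lborel {0..p} (\<lambda>l. of_bool (z i \<le> l) :: real)" if "i < n" for i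
      using z[OF that] p by (intro integral_ramp) auto
    show "set_integrable lborel {0..p} (F z)"
      unfolding F_def by (intro set_integral_avg i)
    have "(\<integral>l\<in>{0..p}. F z l \<partial>lborel) = avg n (\<lambda>i. \<integral>l\<in>{0..p}. of_bool (z i \<le> l) \<partial>lborel)"
      unfolding F_def by (intro set_integral_avg i)
    also have "\<dots> = A z"
      using z p by (auto intro!: avg_cong integral_ramp simp: A_def)
    finally show "A z = (\<integral>l\<in>{0..p}. F z l \<partial>lborel)" ..
  qed
  have B_int: "B z = (\<integral>l\<in>{p..1}. G z l \<partial>lborel)" "set_integrable lborel {p..1} (G z)"
    if z: "\<And>i. i < n \<Longrightarrow> z i \<in> {0..1}" for z
  proof -
    have i: "set_integrable lborel {p..1} (\<lambda>l. of_bool (l \<le> z i) :: real)" if "i < n" for i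
      using z[OF that] p by (intro integral_upper_ramp) auto
    show "set_integrable lborel {p..1} (G z)"
      unfolding G_def by (intro set_integral_avg i)
    have "(\<integral>l\<in>{p..1}. G z l \<partial>lborel) = avg n (\<lambda>i. \<integral>l\<in>{p..1}. of_bool (l \<le> z i) \<partial>lborel)"
      unfolding G_def by (intro set_integral_avg i)
    also have "\<dots> = B z"
      using z p by (auto intro!: avg_cong integral_upper_ramp simp: B_def)
    finally show "B z = (\<integral>l\<in>{p..1}. G z l \<partial>lborel)" ..
  qed
  have const: "set_integrable lborel {a..b} (\<lambda>_. d)" "(\<integral>l\<in>{a..b}. d \<partial>lborel) = (b - a) * d"
    if "a \<le> b" for a b :: real
    using that by (auto simp: set_integrable_def set_lebesgue_integral_def)
  have eqA: "A x = (\<integral>l\<in>{0..p}. F x l \<partial>lborel)" "A y = (\<integral>l\<in>{0..p}. F y l \<partial>lborel)"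
    and eqB: "B x = (\<integral>l\<in>{p..1}. G x l \<partial>lborel)" "B y = (\<integral>l\<in>{p..1}. G y l \<partial>lborel)"
    using xy by (auto intro!: A_int B_int simp del: atLeastAtMost_iff)
  have iA: "set_integrable lborel {0..p} (F y)" and iA': "set_integrable lborel {0..p} (F x)"
    using xy by (auto intro!: A_int simp del: atLeastAtMost_iff)
  have iB: "set_integrable lborel {p..1} (G y)" and iB': "set_integrable lborel {p..1} (G x)"
    using xy by (auto intro!: B_int simp del: atLeastAtMost_iff)
  have "A x \<le> (\<integral>l\<in>{0..p}. F y l + d \<partial>lborel)"
    unfolding eqA(1) using p F
    by (intro set_integral_mono set_integral_add iA iA' const) auto
  also have "\<dots> = A y + p * d"
    using const[of 0 p] iA p unfolding eqA(2) by (subst set_integral_add) auto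
  finally have A: "A x \<le> A y + p * d" .
  have "B x \<le> (\<integral>l\<in>{p..1}. G y l + d \<partial>lborel)"
    unfolding eqB(1) using p G
    by (intro set_integral_mono set_integral_add iB iB' const) auto
  also have "\<dots> = B y + (1 - p) * d"
    using const[of p 1] iB p unfolding eqB(2) by (subst set_integral_add) auto
  finally have B: "B x \<le> B y + (1 - p) * d" .
  have "A x * G x p \<le> (A y + p * d) * G x p"
    using A by (intro mult_right_mono) (auto simp: G_def intro!: unit nonneg)
  also have "\<dots> \<le> A y * (G y p + d) + p * d * 1"
    unfolding distrib_right using p xy(2) G[of p] d
    by (intro add_mono mult_mono mult_left_mono mult_nonneg_nonneg)
      (auto simp: G_def A_def intro!: unit nonneg)
  also have "\<dots> \<le> A y * G y p + 2 * p * d"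
  proof -
    have "A y * d \<le> p * d"
      using p xy(2) d unfolding A_def by (intro mult_right_mono unit) auto
    then show ?thesis by (simp add: algebra_simps)
  qed
  finally have 1: "A x * G x p \<le> A y * G y p + 2 * p * d" .
  have "B x * F x p \<le> (B y + (1 - p) * d) * F x p"
    using B by (intro mult_right_mono) (auto simp: F_def intro!: unit nonneg)
  also have "\<dots> \<le> B y * (F y p + d) + (1 - p) * d * 1"
    unfolding distrib_right using p xy(2) F[of p] d
    by (intro add_mono mult_mono mult_left_mono mult_nonneg_nonneg)
      (auto simp: F_def B_def intro!: unit nonneg)
  also have "\<dots> \<le> B y * F y p + 2 * (1 - p) * d"
  proof -
    have "B y * d \<le> (1 - p) * d"
      using p xy(2) d unfolding B_def by (intro mult_right_mono unit) auto
    then show ?thesis by (simp add: algebra_simps)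
  qed
  finally have 2: "B x * F x p \<le> B y * F y p + 2 * (1 - p) * d" .
  show ?thesis
    using 1 2 by (simp add: avg_gft A_def B_def F_def G_def algebra_simps)
qed

section \<open>The expected gain of a fixed price\<close>

context iid_valuations
begin

text \<open>The integrated distribution function: convex in \<open>p\<close>, with
  \<open>measure \<nu> {..p}\<close> as a subgradient at \<open>p\<close>.\<close>

definition below :: "real \<Rightarrow> real" where
  "below p = (\<integral>x. max 0 (p - x) \<partial>\<nu>)"

definition above :: "real \<Rightarrow> real" where
  "above p = (\<integral>x. max 0 (x - p) \<partial>\<nu>)"

lemma integrable_law_simple:
  "integrable \<nu> (\<lambda>x. max 0 (p - x))" "integrable \<nu> (\<lambda>x. max 0 (x - p))"
  "integrable \<nu> (\<lambda>x. x)" "integrable \<nu> (\<lambda>x. x\<^sup>2)"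
  "integrable \<nu> (\<lambda>x. of_bool (p \<le> x) :: real)" "integrable \<nu> (\<lambda>x. of_bool (x \<le> p) :: real)"
proof -
  show "integrable \<nu> (\<lambda>x. max 0 (p - x))" "integrable \<nu> (\<lambda>x. max 0 (x - p))"
    "integrable \<nu> (\<lambda>x. of_bool (p \<le> x) :: real)" "integrable \<nu> (\<lambda>x. of_bool (x \<le> p) :: real)"
    "integrable \<nu> (\<lambda>x. x)"
    by (auto intro!: integrable_law_bounded[where C = "\<bar>p\<bar> + 1"])
  show "integrable \<nu> (\<lambda>x. x\<^sup>2)"
    by (auto intro!: integrable_law_bounded[where C = 1] power_le_one)
qed

lemma integral_of_bool:
  assumes "A \<in> sets borel"
  shows "(\<integral>x. of_bool (x \<in> A) \<partial>\<nu>) = measure \<nu> A"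
proof -
  have "(\<integral>x. of_bool (x \<in> A) \<partial>\<nu>) = (\<integral>x. indicat_real A x \<partial>\<nu>)"
    by (intro Bochner_Integration.integral_cong) (auto simp: indicator_def)
  then show ?thesis using assms by (simp add: sets_law)
qed

text \<open>The counterpart of \<open>avg_gft\<close> for the law itself: independence of the two
  valuations replaces the double average.\<close>

lemma expected_gft_eq:
  "expected_gft p = 2 * (below p * measure \<nu> {p..} + above p * measure \<nu> {..p})"
proof -
  define F :: "real \<Rightarrow> real" where "F x = of_bool (x \<le> p)" for x
  define G :: "real \<Rightarrow> real" where "G x = of_bool (p \<le> x)" for x
  define A where "A x = max 0 (p - x)" for x
  define B where "B x = max 0 (x - p)" for x
  have [measurable]: "F \<in> borel_measurable borel" "G \<in> borel_measurable borel"
    "A \<in> borel_measurable borel" "B \<in> borel_measurable borel"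
    unfolding F_def G_def A_def B_def by measurable
  have bd: "\<bar>F x\<bar> \<le> 1" "\<bar>G x\<bar> \<le> 1" "\<bar>A x\<bar> \<le> \<bar>p\<bar> + 1" "\<bar>B x\<bar> \<le> \<bar>p\<bar> + 1"
    if "x \<in> {0..1}" for x
    using that by (auto simp: F_def G_def A_def B_def)
  have FB: "(\<integral>z. F (fst z) * B (snd z) \<partial>(\<nu> \<Otimes>\<^sub>M \<nu>)) = (\<integral>x. F x \<partial>\<nu>) * (\<integral>x. B x \<partial>\<nu>)"
      "integrable (\<nu> \<Otimes>\<^sub>M \<nu>) (\<lambda>z. F (fst z) * B (snd z))"
    and AG: "(\<integral>z. A (fst z) * G (snd z) \<partial>(\<nu> \<Otimes>\<^sub>M \<nu>)) = (\<integral>x. A x \<partial>\<nu>) * (\<integral>x. G x \<partial>\<nu>)"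
      "integrable (\<nu> \<Otimes>\<^sub>M \<nu>) (\<lambda>z. A (fst z) * G (snd z))"
    and BF: "(\<integral>z. B (fst z) * F (snd z) \<partial>(\<nu> \<Otimes>\<^sub>M \<nu>)) = (\<integral>x. B x \<partial>\<nu>) * (\<integral>x. F x \<partial>\<nu>)"
      "integrable (\<nu> \<Otimes>\<^sub>M \<nu>) (\<lambda>z. B (fst z) * F (snd z))"
    and GA: "(\<integral>z. G (fst z) * A (snd z) \<partial>(\<nu> \<Otimes>\<^sub>M \<nu>)) = (\<integral>x. G x \<partial>\<nu>) * (\<integral>x. A x \<partial>\<nu>)"
      "integrable (\<nu> \<Otimes>\<^sub>M \<nu>) (\<lambda>z. G (fst z) * A (snd z))"
    by (rule integral_pair_prod, simp, simp, erule bd, erule bd)+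
  have m: "(\<integral>x. F x \<partial>\<nu>) = measure \<nu> {..p}" "(\<integral>x. G x \<partial>\<nu>) = measure \<nu> {p..}"
    using integral_of_bool[of "{..p}"] integral_of_bool[of "{p..}"] by (simp_all add: F_def G_def)
  have "expected_gft p = (\<integral>z. F (fst z) * B (snd z) + G (snd z) * A (fst z)
      + F (snd z) * B (fst z) + G (fst z) * A (snd z) \<partial>(\<nu> \<Otimes>\<^sub>M \<nu>))"
    unfolding expected_gft_def gft_decomp F_def G_def A_def B_def by simp
  also have "\<dots> = (\<integral>z. F (fst z) * B (snd z) + A (fst z) * G (snd z)
      + B (fst z) * F (snd z) + G (fst z) * A (snd z) \<partial>(\<nu> \<Otimes>\<^sub>M \<nu>))"
    by (simp add: mult.commute)
  also have "\<dots> = 2 * (below p * measure \<nu> {p..} + above p * measure \<nu> {..p})"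
    by (simp add: FB AG BF GA m below_def above_def flip: A_def B_def)
  finally show ?thesis .
qed

lemma above_minus_below: "above p - below p = mean \<nu> - p"
proof -
  have "above p - below p = (\<integral>x. max 0 (x - p) - max 0 (p - x) \<partial>\<nu>)"
    unfolding above_def below_def
    by (intro Bochner_Integration.integral_diff[symmetric] integrable_law_simple)
  also have "\<dots> = (\<integral>x. x - p \<partial>\<nu>)"
    by (intro Bochner_Integration.integral_cong) auto
  also have "\<dots> = mean \<nu> - p"
    using integrable_law_simple(3) by (simp add: mean_def N.prob_space)
  finally show ?thesis .
qed

text \<open>Eliminating \<open>above\<close> through \<open>above_minus_below\<close> exposes the
  supporting line of \<open>below\<close> at \<open>p\<close>, evaluated at the mean. The last term
  is the excess due to an atom at \<open>p\<close>.\<close>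

lemma expected_gft_eq_mean:
  "expected_gft p = 2 * (below p + measure \<nu> {..p} * (mean \<nu> - p)) + 2 * below p * measure \<nu> {p}"
proof -
  have "measure \<nu> ({..<p} \<union> {p}) = measure \<nu> {..<p} + measure \<nu> {p}"
    by (intro N.finite_measure_Union) (auto simp: sets_law)
  moreover have "{..<p} \<union> {p} = {..p}" by auto
  moreover have "space \<nu> - {..<p} = {p..}" by auto
  ultimately have "measure \<nu> {p..} = 1 - measure \<nu> {..p} + measure \<nu> {p}"
    using N.prob_compl[of "{..<p}"] by (simp add: sets_law)
  then show ?thesis
    unfolding expected_gft_eq above_minus_below[symmetric] by algebra
qed

text \<open>The error of the supporting line is the integral of a function that is nonnegative,
  vanishes outside the half-open interval between \<open>p\<close> and \<open>q\<close>, and is at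
  most \<open>\<bar>q - p\<bar>\<close> on it.\<close>

lemma below_tangent:
  "0 \<le> below q - below p - measure \<nu> {..p} * (q - p)"
  "below q - below p - measure \<nu> {..p} * (q - p) \<le> \<bar>q - p\<bar> * measure \<nu> {min q p<..max q p}"
proof -
  have int: "integrable \<nu> (\<lambda>x. max 0 (q - x) - max 0 (p - x) - of_bool (x \<le> p) * (q - p))"
    by (intro Bochner_Integration.integrable_diff integrable_law_simple integrable_mult_left)
  have eq: "below q - below p - measure \<nu> {..p} * (q - p) =
    (\<integral>x. max 0 (q - x) - max 0 (p - x) - of_bool (x \<le> p) * (q - p) \<partial>\<nu>)"
    using integral_of_bool[of "{..p}"]
    by (simp add: below_def integrable_law_simple integrable_mult_left)
  show "0 \<le> below q - below p - measure \<nu> {..p} * (q - p)"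
    unfolding eq by (intro integral_nonneg_AE) auto
  have "below q - below p - measure \<nu> {..p} * (q - p) \<le>
      (\<integral>x. \<bar>q - p\<bar> * indicator {min q p<..max q p} x \<partial>\<nu>)"
    unfolding eq
  proof (rule integral_mono[OF int])
    show "integrable \<nu> (\<lambda>x. \<bar>q - p\<bar> * indicator {min q p<..max q p} x)"
      by (rule integrable_law_bounded[where C = "\<bar>q - p\<bar>"]) (auto simp: indicator_def)
  qed (auto simp: indicator_def)
  also have "\<dots> = \<bar>q - p\<bar> * measure \<nu> {min q p<..max q p}"
    by (simp add: sets_law)
  finally show "below q - below p - measure \<nu> {..p} * (q - p) \<le> \<bar>q - p\<bar> * measure \<nu> {min q p<..max q p}" .
qed

lemma below_le_1:
  assumes "p \<in> {0..1}" shows "below p \<le> 1"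
  unfolding below_def
proof (rule N.integral_le_const[OF integrable_law_simple(1)])
  show "AE x in \<nu>. max 0 (p - x) \<le> 1"
    using AE_law_unit by eventually_elim (use assms in auto)
qed

lemma below_nonneg: "0 \<le> below p"
  by (simp add: below_def)

lemma expected_gft_gap:
  assumes "q \<in> {0..1}"
  shows "expected_gft q - expected_gft p \<le>
    2 * measure \<nu> {q} + 2 * \<bar>mean \<nu> - p\<bar> * measure \<nu> {min (mean \<nu>) p<..max (mean \<nu>) p}"
proof -
  have "below q * measure \<nu> {q} \<le> 1 * measure \<nu> {q}"
    using below_le_1[OF assms] by (intro mult_right_mono) auto
  moreover have "0 \<le> below p * measure \<nu> {p}"
    using below_nonneg by simp
  ultimately show ?thesis
    using below_tangent(1)[where q = "mean \<nu>" and p = q]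
      below_tangent(2)[where q = "mean \<nu>" and p = p]
    unfolding expected_gft_eq_mean by (simp add: algebra_simps)
qed

lemma mean_unit: "mean \<nu> \<in> {0..1}"
proof -
  have "0 \<le> mean \<nu>" unfolding mean_def
    using AE_law_unit by (intro integral_nonneg_AE) (auto elim: eventually_mono)
  moreover have "mean \<nu> \<le> 1" unfolding mean_def
    using AE_law_unit by (intro N.integral_le_const integrable_law_simple) (auto elim: eventually_mono)
  ultimately show ?thesis by simp
qed

text \<open>On the unit interval \<open>x\<^sup>2 \<le> x\<close>, so the variance is at most the
  mean minus its square.\<close>

lemma variance_le: "(\<integral>x. (x - mean \<nu>)\<^sup>2 \<partial>\<nu>) \<le> 1 / 4"
proof -
  have "(\<integral>x. (x - mean \<nu>)\<^sup>2 \<partial>\<nu>) = (\<integral>x. x\<^sup>2 - 2 * mean \<nu> * x + (mean \<nu>)\<^sup>2 \<partial>\<nu>)"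
    by (intro Bochner_Integration.integral_cong) (auto simp: power2_eq_square algebra_simps)
  also have "\<dots> = (\<integral>x. x\<^sup>2 \<partial>\<nu>) - 2 * mean \<nu> * (\<integral>x. x \<partial>\<nu>) + (mean \<nu>)\<^sup>2"
    using integrable_law_simple(3,4) by (simp add: N.prob_space)
  also have "(\<integral>x. x\<^sup>2 \<partial>\<nu>) \<le> (\<integral>x. x \<partial>\<nu>)"
  proof (rule integral_mono_AE[OF integrable_law_simple(4,3)])
    show "AE x in \<nu>. x\<^sup>2 \<le> x"
      using AE_law_unit by eventually_elim (auto simp: power2_eq_square mult_left_le)
  qed
  finally show ?thesis
    using diff_square_le_quarter[of "mean \<nu>"] by (simp add: mean_def[symmetric] power2_eq_square)
qed

lemma sample_mean_square_error:
  assumes n: "n > 0"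
  shows "(\<integral>\<omega>. (mean \<nu> - (\<Sum>i<n. \<omega> i) / n)\<^sup>2 \<partial>Omega \<nu>) \<le> 1 / (4 * n)"
proof -
  define m where "m = mean \<nu>"
  have m01: "0 \<le> m" "m \<le> 1" using mean_unit by (auto simp: m_def)
  have cov_int: "integrable (Omega \<nu>) (\<lambda>\<omega>. (\<omega> i - m) * (\<omega> j - m))" for i j
  proof (rule integrable_Omega_bounded[where C = "1 * 1"])
    fix \<omega> :: "nat \<Rightarrow> real" assume "\<And>i. \<omega> i \<in> {0..1}"
    then have "0 \<le> \<omega> k \<and> \<omega> k \<le> 1" for k by simp
    then have "\<bar>\<omega> k - m\<bar> \<le> 1" for k
      using m01 unfolding abs_le_iff by (smt (verit))
    then show "\<bar>(\<omega> i - m) * (\<omega> j - m)\<bar> \<le> 1 * 1"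
      unfolding abs_mult by (intro mult_mono) auto
  qed simp
  have cov: "(\<integral>\<omega>. (\<omega> i - m) * (\<omega> j - m) \<partial>Omega \<nu>) \<le> (if i = j then 1 / 4 else 0)" for i j
  proof (cases "i = j")
    case True
    have "(\<integral>\<omega>. (\<omega> i - m)\<^sup>2 \<partial>Omega \<nu>) = (\<integral>x. (x - m)\<^sup>2 \<partial>distr (Omega \<nu>) \<nu> (\<lambda>\<omega>. \<omega> i))"
      by (subst integral_distr) simp_all
    then show ?thesis
      using True variance_le by (simp add: distr_coordinate power2_eq_square m_def)
  next
    case False
    have bd: "\<bar>x - m\<bar> \<le> 1" if "x \<in> {0..1}" for x
      using that m01 by (auto simp: abs_le_iff)
    have "(\<integral>\<omega>. (\<omega> i - m) * (\<omega> j - m) \<partial>Omega \<nu>) = (\<integral>x. x - m \<partial>\<nu>) * (\<integral>x. x - m \<partial>\<nu>)"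
      using integral_two_coordinates[OF False, of "\<lambda>z. (fst z - m) * (snd z - m)"]
        integral_pair_prod(1)[of "\<lambda>x. x - m" "\<lambda>x. x - m" 1 1] bd by simp
    also have "(\<integral>x. x - m \<partial>\<nu>) = 0"
      using integrable_law_simple(3) by (simp add: N.prob_space m_def mean_def)
    finally show ?thesis using False by simp
  qed
  have "(\<integral>\<omega>. (m - (\<Sum>i<n. \<omega> i) / n)\<^sup>2 \<partial>Omega \<nu>) =
      (\<integral>\<omega>. (\<Sum>i<n. \<Sum>j<n. (\<omega> i - m) * (\<omega> j - m)) / n\<^sup>2 \<partial>Omega \<nu>)"
  proof (intro Bochner_Integration.integral_cong refl)
    fix \<omega> :: "nat \<Rightarrow> real"
    have "m - (\<Sum>i<n. \<omega> i) / n = - ((\<Sum>i<n. \<omega> i - m) / n)"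
      using n by (simp add: sum_subtractf field_simps)
    then show "(m - (\<Sum>i<n. \<omega> i) / n)\<^sup>2 = (\<Sum>i<n. \<Sum>j<n. (\<omega> i - m) * (\<omega> j - m)) / n\<^sup>2"
      by (simp add: power_divide power2_eq_square sum_product)
  qed
  also have "\<dots> = (\<Sum>i<n. \<Sum>j<n. \<integral>\<omega>. (\<omega> i - m) * (\<omega> j - m) \<partial>Omega \<nu>) / n\<^sup>2"
    by (simp add: cov_int Bochner_Integration.integral_sum Bochner_Integration.integrable_sum)
  also have "\<dots> \<le> (\<Sum>i<n. \<Sum>j<n. if i = j then 1 / 4 else 0) / n\<^sup>2"
    by (intro divide_right_mono sum_mono cov) simp
  also have "\<dots> = 1 / (4 * n)"
    using n by (simp add: power2_eq_square)
  finally show ?thesis by (simp add: m_def)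
qed

text \<open>On the unit square \<open>\<bar>x - y\<bar> \<le> x * (1 - y) + y * (1 - x)\<close>,
  whose expectation is twice the mean minus its square. This bounds the loss of the first round in
  the density case.\<close>

lemma expected_gft_le_half: "expected_gft p \<le> 1 / 2"
proof -
  define f where "f x = x" for x :: real
  define g where "g x = (1::real)" for x :: real
  have f: "(\<integral>x. f x \<partial>\<nu>) = mean \<nu>" "(\<integral>x. g x \<partial>\<nu>) = 1"
    by (simp_all add: f_def g_def mean_def N.prob_space)
  have [measurable]: "f \<in> borel_measurable borel" "g \<in> borel_measurable borel"
    unfolding f_def g_def by auto
  have bd: "\<bar>f x\<bar> \<le> 1" "\<bar>g x\<bar> \<le> 1" if "x \<in> {0..1}" for x
    using that by (auto simp: f_def g_def)
  have fg: "(\<integral>z. f (fst z) * g (snd z) \<partial>(\<nu> \<Otimes>\<^sub>M \<nu>)) = (\<integral>x. f x \<partial>\<nu>) * (\<integral>x. g x \<partial>\<nu>)"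
      "integrable (\<nu> \<Otimes>\<^sub>M \<nu>) (\<lambda>z. f (fst z) * g (snd z))"
    and gf: "(\<integral>z. g (fst z) * f (snd z) \<partial>(\<nu> \<Otimes>\<^sub>M \<nu>)) = (\<integral>x. g x \<partial>\<nu>) * (\<integral>x. f x \<partial>\<nu>)"
      "integrable (\<nu> \<Otimes>\<^sub>M \<nu>) (\<lambda>z. g (fst z) * f (snd z))"
    and ff: "(\<integral>z. f (fst z) * f (snd z) \<partial>(\<nu> \<Otimes>\<^sub>M \<nu>)) = (\<integral>x. f x \<partial>\<nu>) * (\<integral>x. f x \<partial>\<nu>)"
      "integrable (\<nu> \<Otimes>\<^sub>M \<nu>) (\<lambda>z. f (fst z) * f (snd z))"
    by (rule integral_pair_prod, simp, simp, erule bd, erule bd)+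
  have int: "integrable (\<nu> \<Otimes>\<^sub>M \<nu>) (\<lambda>z. f (fst z) * g (snd z) + g (fst z) * f (snd z)
      - 2 * (f (fst z) * f (snd z)))"
    by (intro Bochner_Integration.integrable_diff Bochner_Integration.integrable_add
      integrable_mult_right fg gf ff)
  have "expected_gft p \<le> (\<integral>z. f (fst z) * g (snd z) + g (fst z) * f (snd z)
      - 2 * (f (fst z) * f (snd z)) \<partial>(\<nu> \<Otimes>\<^sub>M \<nu>))"
    unfolding expected_gft_def
  proof (rule integral_mono_AE[OF integrable_gft int])
    show "AE z in \<nu> \<Otimes>\<^sub>M \<nu>. gft p (fst z) (snd z) \<le>
        f (fst z) * g (snd z) + g (fst z) * f (snd z) - 2 * (f (fst z) * f (snd z))"
      using AE_pair_unit
    proof eventually_elim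
      case (elim z)
      obtain x y where z: "z = (x, y)" by force
      have "0 \<le> x * (1 - y)" "0 \<le> y * (1 - x)"
        using elim z by auto
      then have "\<bar>x - y\<bar> \<le> x + y - 2 * (x * y)"
        by (auto simp: abs_if algebra_simps)
      then show ?case
        using gft_le[of p x y] by (simp add: z f_def g_def)
    qed
  qed
  also have "\<dots> = 2 * (mean \<nu> - (mean \<nu>)\<^sup>2)"
    by (simp add: fg gf ff f power2_eq_square)
  finally show ?thesis using diff_square_le_quarter[of "mean \<nu>"] by simp
qed

end

section \<open>Symmetrisation\<close>

lemma integral_sum_real:
  fixes f :: "'i \<Rightarrow> 'a \<Rightarrow> real"
  assumes "\<And>i. i \<in> I \<Longrightarrow> integrable M (f i)"
  shows "(\<integral>x. (\<Sum>i\<in>I. f i x) \<partial>M) = (\<Sum>i\<in>I. \<integral>x. f i x \<partial>M)"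
  using assms by (rule Bochner_Integration.integral_sum)

text \<open>The coordinates \<open>n, \<dots>, 2n - 1\<close> of a path serve as a ghost copy of its first \<open>n\<close> coordinates.\<close>

definition swap_copies :: "nat \<Rightarrow> nat set \<Rightarrow> nat \<Rightarrow> nat" where
  "swap_copies n S k = (if k \<in> S then k + n else if n \<le> k \<and> k - n \<in> S then k - n else k)"

lemma inj_swap_copies:
  assumes "S \<subseteq> {..<n}" shows "inj (swap_copies n S)"
proof (rule inj_on_inverseI)
  show "swap_copies n S (swap_copies n S k) = k" for k
    proof (cases "k \<in> S")
    case True
    then have "k + n \<notin> S" using assms by auto
    with True show ?thesis by (simp add: swap_copies_def)
  qed (auto simp: swap_copies_def)
qed

definition cdf_diff :: "nat \<Rightarrow> (nat \<Rightarrow> real) \<Rightarrow> real \<Rightarrow> real" where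
  "cdf_diff n \<omega> x = (\<Sum>i<n. of_bool (\<omega> i \<le> x) - of_bool (\<omega> (n + i) \<le> x))"

text \<open>Exchanging the two copies at an index reverses the sign of its summand, which turns the
  difference into a difference of two signed threshold sums.\<close>

lemma cdf_diff_swap:
  assumes "S \<subseteq> {..<n}"
  shows "cdf_diff n (\<lambda>i. \<omega> (swap_copies n S i)) x =
    (\<Sum>i<n. flip_sign S i * of_bool (\<omega> i \<le> x)) - (\<Sum>i<n. flip_sign S i * of_bool (\<omega> (n + i) \<le> x))"
  unfolding cdf_diff_def sum_subtractf[symmetric]
proof (intro sum.cong refl)
  fix i assume i: "i \<in> {..<n}"
  have "n + i \<notin> S" using assms by auto
  then show "of_bool (\<omega> (swap_copies n S i) \<le> x) - of_bool (\<omega> (swap_copies n S (n + i)) \<le> x) =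
      flip_sign S i * of_bool (\<omega> i \<le> x) - flip_sign S i * of_bool (\<omega> (n + i) \<le> x)"
    using i by (auto simp: swap_copies_def flip_sign_def add.commute)
qed

text \<open>The supremum over all thresholds, taken over the \<open>2 * n\<close> sample points
  only: the difference jumps nowhere else, and a finite maximum is visibly measurable.\<close>

definition max_cdf_diff :: "nat \<Rightarrow> (nat \<Rightarrow> real) \<Rightarrow> real" where
  "max_cdf_diff n \<omega> = Max ((\<lambda>k. \<bar>cdf_diff n \<omega> (\<omega> k)\<bar>) ` {..<2 * n})"

lemma max_cdf_diff_ge:
  assumes "k < 2 * n"
  shows "\<bar>cdf_diff n \<omega> (\<omega> k)\<bar> \<le> max_cdf_diff n \<omega>"
  unfolding max_cdf_diff_def using assms by (intro Max_ge) auto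

text \<open>A down-set selects the same sample points as the closed half-line ending at the largest
  sample point in it, or selects none. Down-sets cover closed and open half-lines, hence
  distribution functions and their left limits, at once.\<close>

lemma max_cdf_diff_downset:
  assumes n: "0 < n" and U: "\<And>x y. x \<in> U \<Longrightarrow> y \<le> x \<Longrightarrow> y \<in> U"
  shows "\<bar>\<Sum>i<n. of_bool (\<omega> i \<in> U) - of_bool (\<omega> (n + i) \<in> U)\<bar> \<le> max_cdf_diff n \<omega>"
proof (cases "\<exists>k<2 * n. \<omega> k \<in> U")
  case False
  then have "(\<Sum>i<n. of_bool (\<omega> i \<in> U) - of_bool (\<omega> (n + i) \<in> U)) = (\<Sum>i<n. 0 :: real)"
    by (intro sum.cong) auto
  then show ?thesis
    using max_cdf_diff_ge[of 0 n \<omega>] n by simp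
next
  case True
  define K where "K = {k. k < 2 * n \<and> \<omega> k \<in> U}"
  have K: "finite K" "K \<noteq> {}" using True by (auto simp: K_def)
  then have "Max (\<omega> ` K) \<in> \<omega> ` K" by (intro Max_in) auto
  then obtain k where k: "k \<in> K" "\<omega> k = Max (\<omega> ` K)" by auto
  have "\<omega> j \<in> U \<longleftrightarrow> \<omega> j \<le> \<omega> k" if "j < 2 * n" for j
  proof
    assume "\<omega> j \<in> U"
    then show "\<omega> j \<le> \<omega> k" unfolding k(2) using K that by (intro Max_ge) (auto simp: K_def)
  qed (use U k(1) in \<open>auto simp: K_def\<close>)
  then have "(\<Sum>i<n. of_bool (\<omega> i \<in> U) - of_bool (\<omega> (n + i) \<in> U)) = cdf_diff n \<omega> (\<omega> k)"
    unfolding cdf_diff_def by (intro sum.cong) auto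
  then show ?thesis
    using max_cdf_diff_ge[of k n \<omega>] k(1) by (simp add: K_def)
qed

text \<open>The path is fixed and only the signs vary. The maximal inequality applies to each copy
  separately, with no relation needed between the two walks; each contributes
  \<open>2 * sqrt n\<close>.\<close>

lemma sum_max_cdf_diff_swap:
  assumes n: "0 < n"
  shows "(\<Sum>S\<in>Pow {..<n}. max_cdf_diff n (\<lambda>i. \<omega> (swap_copies n S i))) \<le> 2 ^ n * (4 * sqrt n)"
proof -
  obtain M where M: "\<And>S x. S \<subseteq> {..<n} \<Longrightarrow> \<bar>\<Sum>i<n. flip_sign S i * of_bool (\<omega> i \<le> x)\<bar> \<le> M S"
    "(\<Sum>S\<in>Pow {..<n}. M S) \<le> 2 ^ n * (2 * sqrt n)"
    using rademacher_maximal[of n \<omega>] by auto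
  obtain M' where M': "\<And>S x. S \<subseteq> {..<n} \<Longrightarrow>
      \<bar>\<Sum>i<n. flip_sign S i * of_bool (\<omega> (n + i) \<le> x)\<bar> \<le> M' S"
    "(\<Sum>S\<in>Pow {..<n}. M' S) \<le> 2 ^ n * (2 * sqrt n)"
    using rademacher_maximal[of n "\<lambda>i. \<omega> (n + i)"] by auto
  have "max_cdf_diff n (\<lambda>i. \<omega> (swap_copies n S i)) \<le> M S + M' S" if "S \<in> Pow {..<n}" for S
  proof -
    have "\<bar>cdf_diff n (\<lambda>i. \<omega> (swap_copies n S i)) x\<bar> \<le> M S + M' S" for x
      using M(1)[of S x] M'(1)[of S x] that by (simp add: cdf_diff_swap)
    then show ?thesis
      unfolding max_cdf_diff_def using n by (intro Max.boundedI) (auto simp: lessThan_empty_iff)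
  qed
  then have "(\<Sum>S\<in>Pow {..<n}. max_cdf_diff n (\<lambda>i. \<omega> (swap_copies n S i))) \<le>
      (\<Sum>S\<in>Pow {..<n}. M S + M' S)"
    by (rule sum_mono)
  also have "\<dots> \<le> 2 ^ n * (4 * sqrt n)"
    using M(2) M'(2) by (simp add: sum.distrib)
  finally show ?thesis .
qed

lemma max_cdf_diff_bounded:
  assumes "0 < n" shows "\<bar>max_cdf_diff n \<omega>\<bar> \<le> n"
proof -
  have "\<bar>cdf_diff n \<omega> x\<bar> \<le> (\<Sum>i<n. 1)" for x
    unfolding cdf_diff_def by (intro order_trans[OF sum_abs] sum_mono) auto
  then have "max_cdf_diff n \<omega> \<le> n"
    unfolding max_cdf_diff_def using assms by (intro Max.boundedI) (auto simp: lessThan_empty_iff)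
  moreover have "0 \<le> max_cdf_diff n \<omega>"
    using max_cdf_diff_ge[of 0 n \<omega>] assms by simp
  ultimately show ?thesis by simp
qed

definition emp_gft :: "nat \<Rightarrow> (nat \<Rightarrow> real) \<Rightarrow> real \<Rightarrow> real" where
  "emp_gft n x p = avg n (\<lambda>i. avg n (\<lambda>j. gft p (x i) (x j)))"

text \<open>The error does not depend on \<open>p\<close>, so a price computed from the sample
  itself may be inserted.\<close>

lemma emp_gft_ghost:
  assumes n: "0 < n" and p: "p \<in> {0..1}" and \<omega>: "\<And>i. \<omega> i \<in> {0..1}"
  shows "emp_gft n \<omega> p \<le> emp_gft n (\<lambda>i. \<omega> (n + i)) p + 4 * (max_cdf_diff n \<omega> / n)"
  unfolding emp_gft_def
proof (rule avg_gft_stable[OF n p \<omega> \<omega>])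
  have *: "\<bar>avg n (\<lambda>i. of_bool (\<omega> i \<in> U)) - avg n (\<lambda>i. of_bool (\<omega> (n + i) \<in> U))\<bar>
      \<le> max_cdf_diff n \<omega> / n" if "\<And>x y. x \<in> U \<Longrightarrow> y \<le> x \<Longrightarrow> y \<in> U" for U
    using max_cdf_diff_downset[of n U \<omega>, OF n that] n
    by (simp add: avg_def sum_subtractf diff_divide_distrib[symmetric] abs_divide divide_right_mono)
  show "\<bar>avg n (\<lambda>i. of_bool (\<omega> i \<le> l)) - avg n (\<lambda>i. of_bool (\<omega> (n + i) \<le> l))\<bar> \<le> max_cdf_diff n \<omega> / n" for l
    using *[of "{..l}"] by simp
  show "\<bar>avg n (\<lambda>i. of_bool (\<omega> i < l)) - avg n (\<lambda>i. of_bool (\<omega> (n + i) < l))\<bar> \<le> max_cdf_diff n \<omega> / n" for l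
    using *[of "{..<l}"] by simp
qed

section \<open>Expected distance between the sample and its ghost copy\<close>

context iid_valuations
begin

lemma cdf_diff_measurable [measurable]:
  "(\<lambda>\<omega>. cdf_diff n \<omega> (\<omega> k)) \<in> borel_measurable (Omega \<nu>)"
proof -
  have "(\<lambda>\<omega>. of_bool (\<omega> i \<le> \<omega> k) :: real) \<in> borel_measurable (Omega \<nu>)" for i
  proof (rule measurable_compose[where g = of_bool and N = "count_space UNIV"])
    show "Measurable.pred (Omega \<nu>) (\<lambda>\<omega>. \<omega> i \<le> \<omega> k)"
      unfolding pred_def by (intro borel_measurable_le measurable_coordinate)
  qed simp
  then show ?thesis
    unfolding cdf_diff_def by (intro borel_measurable_sum borel_measurable_diff)
qed

lemma max_cdf_diff_measurable [measurable]: "max_cdf_diff n \<in> borel_measurable (Omega \<nu>)"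
  unfolding max_cdf_diff_def[abs_def] by (intro borel_measurable_Max) auto

lemma integrable_max_cdf_diff:
  assumes "0 < n" shows "integrable (Omega \<nu>) (\<lambda>\<omega>. max_cdf_diff n (\<lambda>i. \<omega> (f i)))"
proof (rule integrable_Omega_bounded[where C = n])
  show "(\<lambda>\<omega>. max_cdf_diff n (\<lambda>i. \<omega> (f i))) \<in> borel_measurable (Omega \<nu>)"
    using measurable_compose[OF measurable_reindex max_cdf_diff_measurable] .
qed (use max_cdf_diff_bounded[OF assms] in auto)

text \<open>Each exchange of copies preserves the law of the path, so the expectation equals its
  average over all exchanges, to which the pathwise bound applies.\<close>

lemma integral_max_cdf_diff_le:
  assumes n: "0 < n"
  shows "(\<integral>\<omega>. max_cdf_diff n \<omega> \<partial>Omega \<nu>) \<le> 4 * sqrt n"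
proof -
  have "2 ^ n * (\<integral>\<omega>. max_cdf_diff n \<omega> \<partial>Omega \<nu>) =
      (\<Sum>S\<in>Pow {..<n}. \<integral>\<omega>. max_cdf_diff n \<omega> \<partial>Omega \<nu>)"
    by (simp add: card_Pow)
  also have "\<dots> = (\<Sum>S\<in>Pow {..<n}. \<integral>\<omega>. max_cdf_diff n (\<lambda>i. \<omega> (swap_copies n S i)) \<partial>Omega \<nu>)"
    by (intro sum.cong integral_reindex[symmetric] inj_swap_copies) auto
  also have "\<dots> = (\<integral>\<omega>. (\<Sum>S\<in>Pow {..<n}. max_cdf_diff n (\<lambda>i. \<omega> (swap_copies n S i))) \<partial>Omega \<nu>)"
    by (intro integral_sum_real[symmetric] integrable_max_cdf_diff n)
  also have "\<dots> \<le> 2 ^ n * (4 * sqrt n)"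
    by (intro O.integral_le_const Bochner_Integration.integrable_sum integrable_max_cdf_diff n AE_I2
        sum_max_cdf_diff_swap)
  finally show ?thesis by simp
qed

lemma emp_gft_measurable [measurable]:
  assumes [measurable]: "P \<in> borel_measurable (Omega \<nu>)"
  shows "(\<lambda>\<omega>. emp_gft n (\<lambda>i. \<omega> (f i)) (P \<omega>)) \<in> borel_measurable (Omega \<nu>)"
  unfolding emp_gft_def avg_def by measurable

text \<open>Of the \<open>n * n\<close> pairs, the \<open>n\<close> diagonal ones gain 0, which
  gives the factor \<open>1 - 1 / n\<close>. The map \<open>f\<close> lets the lemma serve both the
  sample and the ghost sample.\<close>

lemma integral_emp_gft:
  assumes n: "0 < n" and P: "P \<in> borel_measurable (Omega \<nu>)"
    and off: "\<And>i j. i \<noteq> j \<Longrightarrow> (\<integral>\<omega>. gft (P \<omega>) (\<omega> (f i)) (\<omega> (f j)) \<partial>Omega \<nu>) = v"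
  shows "(\<integral>\<omega>. emp_gft n (\<lambda>i. \<omega> (f i)) (P \<omega>) \<partial>Omega \<nu>) = (1 - 1 / n) * v"
    and "integrable (Omega \<nu>) (\<lambda>\<omega>. emp_gft n (\<lambda>i. \<omega> (f i)) (P \<omega>))"
proof -
  have eq: "emp_gft n (\<lambda>i. \<omega> (f i)) (P \<omega>) =
    (\<Sum>i<n. \<Sum>j<n. gft (P \<omega>) (\<omega> (f i)) (\<omega> (f j))) / (real n * real n)" for \<omega>
    by (simp add: emp_gft_def avg_def sum_divide_distrib)
  note int = integrable_gft_price[OF P]
  show "integrable (Omega \<nu>) (\<lambda>\<omega>. emp_gft n (\<lambda>i. \<omega> (f i)) (P \<omega>))"
    unfolding eq by (intro integrable_divide_zero Bochner_Integration.integrable_sum int)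
  have "(\<integral>\<omega>. emp_gft n (\<lambda>i. \<omega> (f i)) (P \<omega>) \<partial>Omega \<nu>) =
      (\<Sum>i<n. \<Sum>j<n. \<integral>\<omega>. gft (P \<omega>) (\<omega> (f i)) (\<omega> (f j)) \<partial>Omega \<nu>) / (real n * real n)"
    unfolding eq by (simp add: integral_sum_real int Bochner_Integration.integrable_sum)
  also have "\<dots> = (\<Sum>i<n. \<Sum>j<n. v - (if i = j then v else 0)) / (real n * real n)"
    by (intro arg_cong2[where f = "(/)"] sum.cong refl) (auto simp: off)
  also have "\<dots> = (1 - 1 / n) * v"
    using n by (simp add: sum_subtractf field_simps)
  finally show "(\<integral>\<omega>. emp_gft n (\<lambda>i. \<omega> (f i)) (P \<omega>) \<partial>Omega \<nu>) = (1 - 1 / n) * v" .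
qed

end

section \<open>The maximiser of the empirical objective\<close>

locale rho_selection = iid_valuations +
  fixes sel :: "real list \<Rightarrow> real"
  assumes sel_argmax: "\<And>xs. xs \<noteq> [] \<Longrightarrow> set xs \<subseteq> {0..1} \<Longrightarrow>
          sel xs \<in> {0..1} \<and> (\<forall>p\<in>{0..1}. rho (emp xs) p \<le> rho (emp xs) (sel xs))"
    and sel_measurable: "\<And>n. (\<lambda>\<omega>. sel (map \<omega> [0..<n])) \<in> borel_measurable (Omega \<nu>)"
begin

lemma sel_emp_gft:
  assumes n: "0 < n" and \<omega>: "\<And>i. \<omega> i \<in> {0..1}"
  shows "sel (map \<omega> [0..<n]) \<in> {0..1}"
    and "q \<in> {0..1} \<Longrightarrow> emp_gft n \<omega> q \<le> emp_gft n \<omega> (sel (map \<omega> [0..<n]))"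
proof -
  define xs where "xs = map \<omega> [0..<n]"
  have xs: "xs \<noteq> []" "set xs \<subseteq> {0..1}" using n \<omega> by (auto simp: xs_def simp del: atLeastAtMost_iff)
  have "rho (emp xs) p = emp_gft n \<omega> p" if "p \<in> {0..1}" for p
    unfolding rho_emp[OF xs that] emp_gft_def avg_def by (simp add: xs_def)
  then show "sel (map \<omega> [0..<n]) \<in> {0..1}"
    "q \<in> {0..1} \<Longrightarrow> emp_gft n \<omega> q \<le> emp_gft n \<omega> (sel (map \<omega> [0..<n]))"
    using sel_argmax[OF xs] by (auto simp: xs_def simp del: atLeastAtMost_iff)
qed

text \<open>A chain of comparisons: the expected gain of \<open>q\<close> is read off the sample,
  the maximiser does at least as well there, its value moves to the ghost sample at the cost of
  \<open>max_cdf_diff\<close>, and independence turns it back into an expected gain. The constant is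
  4 from stability times \<open>4 * sqrt n\<close> from symmetrisation.\<close>

lemma expected_gft_sel:
  assumes n: "0 < n" and q: "q \<in> {0..1}"
  shows "(1 - 1 / n) * expected_gft q - 16 / sqrt n \<le>
      (\<integral>\<omega>. expected_gft (sel (map \<omega> [0..<n])) \<partial>Omega \<nu>)"
proof -
  define P where "P \<omega> = sel (map \<omega> [0..<n])" for \<omega>
  have [measurable]: "P \<in> borel_measurable (Omega \<nu>)"
    unfolding P_def by (rule sel_measurable)
  have past: "P \<omega> = P \<omega>'" if "\<And>k. k < n \<Longrightarrow> \<omega> k = \<omega>' k" for \<omega> \<omega>'
    unfolding P_def using that by (intro arg_cong[where f = sel]) simp
  have x: "(\<integral>\<omega>. emp_gft n \<omega> q \<partial>Omega \<nu>) = (1 - 1 / n) * expected_gft q"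
    "integrable (Omega \<nu>) (\<lambda>\<omega>. emp_gft n \<omega> q)"
    using integral_emp_gft[OF n, of "\<lambda>_. q" "\<lambda>i. i" "expected_gft q"]
    by (simp_all add: integral_gft_coordinates)
  have y: "(\<integral>\<omega>. emp_gft n (\<lambda>i. \<omega> (n + i)) (P \<omega>) \<partial>Omega \<nu>) =
      (1 - 1 / n) * (\<integral>\<omega>. expected_gft (P \<omega>) \<partial>Omega \<nu>)"
    "integrable (Omega \<nu>) (\<lambda>\<omega>. emp_gft n (\<lambda>i. \<omega> (n + i)) (P \<omega>))"
  proof -
    have off: "(\<integral>\<omega>. gft (P \<omega>) (\<omega> (n + i)) (\<omega> (n + j)) \<partial>Omega \<nu>) =
        (\<integral>\<omega>. expected_gft (P \<omega>) \<partial>Omega \<nu>)" if "i \<noteq> j" for i j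
      using that by (intro integral_gft_price[where n = n] past) auto
    show "(\<integral>\<omega>. emp_gft n (\<lambda>i. \<omega> (n + i)) (P \<omega>) \<partial>Omega \<nu>) =
      (1 - 1 / n) * (\<integral>\<omega>. expected_gft (P \<omega>) \<partial>Omega \<nu>)"
      by (rule integral_emp_gft(1)[OF n _ off]) simp_all
    show "integrable (Omega \<nu>) (\<lambda>\<omega>. emp_gft n (\<lambda>i. \<omega> (n + i)) (P \<omega>))"
      by (rule integral_emp_gft(2)[OF n _ off]) simp_all
  qed
  have "(1 - 1 / n) * expected_gft q \<le>
      (\<integral>\<omega>. emp_gft n (\<lambda>i. \<omega> (n + i)) (P \<omega>) + 4 * (max_cdf_diff n \<omega> / n) \<partial>Omega \<nu>)"
    unfolding x(1)[symmetric]
  proof (rule integral_mono_AE[OF x(2)])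
    show "integrable (Omega \<nu>)
      (\<lambda>\<omega>. emp_gft n (\<lambda>i. \<omega> (n + i)) (P \<omega>) + 4 * (max_cdf_diff n \<omega> / n))"
      using integrable_max_cdf_diff[OF n, of "\<lambda>i. i"] y(2) by auto
    show "AE \<omega> in Omega \<nu>. emp_gft n \<omega> q \<le>
        emp_gft n (\<lambda>i. \<omega> (n + i)) (P \<omega>) + 4 * (max_cdf_diff n \<omega> / n)"
      using AE_Omega_unit
    proof eventually_elim
      case (elim \<omega>)
      then have \<omega>: "\<And>i. \<omega> i \<in> {0..1}" by blast
      have "emp_gft n \<omega> q \<le> emp_gft n \<omega> (P \<omega>)"
        unfolding P_def by (rule sel_emp_gft(2)[OF n \<omega> q])
      also have "\<dots> \<le> emp_gft n (\<lambda>i. \<omega> (n + i)) (P \<omega>) + 4 * (max_cdf_diff n \<omega> / n)"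
        unfolding P_def by (intro emp_gft_ghost n sel_emp_gft \<omega>)
      finally show ?case .
    qed
  qed
  also have "\<dots> = (1 - 1 / n) * (\<integral>\<omega>. expected_gft (P \<omega>) \<partial>Omega \<nu>) +
      4 * ((\<integral>\<omega>. max_cdf_diff n \<omega> \<partial>Omega \<nu>) / n)"
    using integrable_max_cdf_diff[OF n, of "\<lambda>i. i"] y by simp
  \<comment> \<open>The diagonal factor is relaxed to 1 on this side only; on the side of
    \<open>q\<close> it remains as a loss of at most \<open>1 / n\<close>.\<close>
  also have "\<dots> \<le> 1 * (\<integral>\<omega>. expected_gft (P \<omega>) \<partial>Omega \<nu>) + 4 * (4 * sqrt n / n)"
    using n integral_max_cdf_diff_le[OF n]
    by (intro add_mono mult_right_mono mult_left_mono divide_right_mono integral_nonneg_AE AE_I2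
        expected_gft_nonneg) auto
  also have "4 * (4 * sqrt n / n) = 16 / sqrt n"
    using n by (simp add: field_simps)
  finally show ?thesis by (simp add: P_def)
qed

end

section \<open>The regret\<close>

lemma harmonic_le: "(\<Sum>k=1..Suc m. 1 / real k) \<le> 1 + ln (real (Suc m))"
proof (induction m)
  case (Suc m)
  define a where "a = real (Suc m)"
  have a: "a > 0" "real (Suc (Suc m)) = a + 1" by (auto simp: a_def)
  \<comment> \<open>Rearranged, \<open>1 / (a + 1) \<le> ln (a + 1) - ln a\<close>, so the sum
    telescopes.\<close>
  have "ln a - ln (a + 1) \<le> a / (a + 1) - 1"
    using ln_le_minus_one[of "a / (a + 1)"] a(1) by (simp add: ln_div)
  also have "\<dots> = - (1 / (a + 1))"
    using a(1) by (simp add: field_simps)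
  finally show ?case
    using Suc by (simp only: a(2) sum.cl_ivl_Suc a_def[symmetric]) (simp add: a_def)
qed simp

lemma sum_inverse_sqrt_le: "(\<Sum>k=1..m. 1 / sqrt (real k)) \<le> 2 * sqrt (real m)"
proof (induction m)
  case (Suc m)
  define a b where "a = sqrt (real m)" and "b = sqrt (real (Suc m))"
  have b: "b > 0" "b * b = a * a + 1"
    by (simp_all add: a_def b_def)
  \<comment> \<open>Since \<open>b * b - a * a = 1\<close>, the product
    \<open>2 * b * (b - a)\<close> equals 1 plus this square; the terms \<open>1 / b\<close> are
    thus bounded by telescoping differences.\<close>
  have "0 \<le> (b - a) * (b - a)" by simp
  then have "1 \<le> (2 * (b - a)) * b"
    using b(2) by (simp add: algebra_simps)
  then have "1 / b \<le> 2 * (b - a)"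
    using b(1) by (simp add: divide_le_eq)
  then show ?case using Suc by (simp add: a_def b_def)
qed simp

lemma sum_head_2: "1 \<le> T \<Longrightarrow> (\<Sum>t=1..T. f t) = f 1 + (\<Sum>t=2..T. f t)" for f :: "nat \<Rightarrow> real"
  by (simp add: sum.atLeast_Suc_atMost numeral_2_eq_2)

lemma sum_shift_2: "(\<Sum>t=2..T. f (t - 1)) = (\<Sum>k=1..T - 1. f k)" for f :: "nat \<Rightarrow> real"
  by (rule sum.reindex_bij_witness[of _ Suc "\<lambda>t. t - 1"]) auto

section \<open>Rounds up to the first collision\<close>

text \<open>Only rounds before \<open>t\<close> are inspected, so the collision round itself is
  still active, in agreement with the mean being posted for \<open>t \<le> tau\<close>.\<close>

definition active :: "(nat \<Rightarrow> real) \<Rightarrow> nat \<Rightarrow> bool" where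
  "active \<omega> t \<longleftrightarrow> (\<forall>s\<in>{1..<t}. \<not> collision \<omega> s)"

lemma tau_ge_iff: "enat t \<le> tau \<omega> \<longleftrightarrow> active \<omega> t"
proof (cases "\<exists>t\<ge>1. collision \<omega> t")
  case True
  define l where "l = (LEAST t. t \<ge> 1 \<and> collision \<omega> t)"
  have l: "l \<ge> 1 \<and> collision \<omega> l"
    unfolding l_def using True by (rule LeastI_ex)
  have "\<not> collision \<omega> s" if "1 \<le> s" "s < l" for s
    using not_less_Least[OF that(2)[unfolded l_def]] that(1) by simp
  then have "active \<omega> t" if "t \<le> l"
    using that by (simp add: active_def)
  moreover have "t \<le> l" if "active \<omega> t"
    using that l by (cases "t \<le> l") (auto simp: active_def)
  moreover have "tau \<omega> = enat l"
    using True by (simp only: tau_def l_def if_True)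
  ultimately show ?thesis by auto
next
  case False
  then have "tau \<omega> = \<infinity>" "active \<omega> t"
    by (simp_all only: tau_def active_def if_False) auto
  then show ?thesis by simp
qed

lemma collision_iff:
  "collision \<omega> s \<longleftrightarrow> (\<exists>u\<in>{1..2*(s-1)}. V \<omega> (2 * s-1) = V \<omega> u \<or> V \<omega> (2 * s) = V \<omega> u)"
  by (auto simp: collision_def)

lemma collision_cong:
  assumes "1 \<le> s" and "\<And>k. k < 2 * s \<Longrightarrow> \<omega> k = \<omega>' k"
  shows "collision \<omega> s = collision \<omega>' s"
proof -
  have "V \<omega> u = V \<omega>' u" if "u \<le> 2 * s" for u
    using assms that by (simp add: V_def)
  then have "V \<omega> ` {1..2 * (s-1)} = V \<omega>' ` {1..2 * (s-1)}"
    "V \<omega> (2 * s-1) = V \<omega>' (2 * s-1)" "V \<omega> (2 * s) = V \<omega>' (2 * s)"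
    by (auto intro!: image_cong)
  then show ?thesis by (simp only: collision_def)
qed

lemma active_cong:
  assumes "\<And>k. k < 2 * (t - 1) \<Longrightarrow> \<omega> k = \<omega>' k"
  shows "active \<omega> t = active \<omega>' t"
  unfolding active_def using assms by (intro ball_cong refl arg_cong[where f = Not] collision_cong) auto

text \<open>The second round whose first valuation is \<open>q\<close> is a collision.\<close>

lemma active_repeats_le:
  "(\<Sum>t=1..T. of_bool (active \<omega> t) * of_bool (V \<omega> (2*t-1) = q)) \<le> (2::real)"
proof -
  define C where "C = {t\<in>{1..T}. active \<omega> t \<and> V \<omega> (2*t-1) = q}"
  have fin: "finite C" by (simp add: C_def)
  \<comment> \<open>With three such rounds, \<open>t\<close> would collide with \<open>s\<close> and
    \<open>u\<close> would no longer be active. Two are possible, because the colliding round is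
    itself active.\<close>
  have no3: False if "s \<in> C" "t \<in> C" "u \<in> C" "s < t" "t < u" for s t u
  proof -
    have "collision \<omega> t"
      unfolding collision_iff using that by (intro bexI[of _ "2 * s-1"]) (auto simp: C_def)
    then show False using that by (auto simp: C_def active_def)
  qed
  have "card C \<le> 2"
  proof (cases "C = {}")
    case False
    have "C \<subseteq> {Min C, Max C}"
    proof
      fix t assume t: "t \<in> C"
      have "Min C \<le> t" "t \<le> Max C" using t fin by auto
      moreover have "Min C \<in> C" "Max C \<in> C" using False fin by auto
      ultimately show "t \<in> {Min C, Max C}" using no3[of "Min C" t "Max C"] t
        by (metis insert_iff order_le_imp_less_or_eq)
    qed
    then have "card C \<le> card {Min C, Max C}" by (intro card_mono) auto
    also have "\<dots> \<le> 2" by (simp add: card_insert_if)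
    finally show ?thesis .
  qed simp
  moreover have "(\<Sum>t=1..T. of_bool (active \<omega> t) * of_bool (V \<omega> (2*t-1) = q)) = (\<Sum>t\<in>C. 1 :: real)"
    unfolding C_def by (intro sum.mono_neutral_cong_right) auto
  ultimately show ?thesis by simp
qed

lemma P_FTM_eq:
  "2 \<le> t \<Longrightarrow> P_FTM \<omega> t = (\<Sum>i<2*(t-1). \<omega> i) / real (2*(t-1))"
  by (auto simp: P_FTM_def V_def sum.atLeast1_atMost_eq of_nat_diff)

lemma P_FTrho_eq:
  assumes "2 \<le> t" shows "P_FTrho sel \<omega> t = sel (map \<omega> [0..<2*(t-1)])"
proof -
  have "map (V \<omega>) [1..<2*(t-1)+1] = map \<omega> [0..<2*(t-1)]"
    by (rule nth_equalityI) (auto simp: V_def simp del: upt_Suc)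
  then show ?thesis using assms by (simp add: P_FTrho_def)
qed

section \<open>Probability of collisions and accuracy of the sample mean\<close>

context iid_valuations
begin

lemma density_bounded_measure_le:
  assumes "density_bounded_by \<nu> M" "0 \<le> M" "A \<in> sets borel" "emeasure lborel A = ennreal l" "0 \<le> l"
  shows "measure \<nu> A \<le> M * l"
proof -
  obtain f where f: "f \<in> borel_measurable borel" "\<And>x. 0 \<le> f x \<and> f x \<le> M"
    and law: "\<nu> = density lborel (\<lambda>x. ennreal (f x))"
    using assms(1) by (auto simp: density_bounded_by_def)
  have "emeasure \<nu> A = (\<integral>\<^sup>+x. ennreal (f x) * indicator A x \<partial>lborel)"
    using f(1) assms(3) by (subst law) (simp add: emeasure_density)
  also have "\<dots> \<le> (\<integral>\<^sup>+x. ennreal M * indicator A x \<partial>lborel)"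
    using f(2) by (intro nn_integral_mono mult_right_mono ennreal_leI) auto
  also have "\<dots> = ennreal (M * l)"
    using assms by (simp add: nn_integral_cmult_indicator ennreal_mult)
  finally show ?thesis
    using assms(2,5) by (simp add: N.emeasure_eq_measure)
qed

lemma density_bounded_interval:
  assumes "density_bounded_by \<nu> M" "0 \<le> M"
  shows "measure \<nu> {min a b<..max a b} \<le> M * \<bar>a - b\<bar>"
  using assms by (intro density_bounded_measure_le) auto

lemma density_bounded_atomless:
  assumes "density_bounded_by \<nu> M" "0 \<le> M"
  shows "measure \<nu> {q} = 0"
  using density_bounded_measure_le[OF assms, of "{q}" 0] by (simp add: measure_le_0_iff)

text \<open>By Fubini the diagonal is null, since each of its sections is a singleton without mass;
  there are only countably many pairs of coordinates.\<close>

lemma AE_distinct: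
  assumes atomless: "\<And>q. measure \<nu> {q} = 0"
  shows "AE \<omega> in Omega \<nu>. \<forall>i j. i \<noteq> j \<longrightarrow> \<omega> i \<noteq> \<omega> j"
proof -
  have "AE x in \<nu>. AE y in \<nu>. x \<noteq> y"
  proof (rule AE_I2)
    fix x
    have "{x} \<in> null_sets \<nu>"
      using atomless[of x] by (intro null_setsI) (auto simp: N.emeasure_eq_measure sets_law)
    then show "AE y in \<nu>. x \<noteq> y"
      by (rule AE_I') auto
  qed
  then have "AE z in \<nu> \<Otimes>\<^sub>M \<nu>. fst z \<noteq> snd z"
    by (intro NN.AE_pair_measure) simp_all
  then have "AE \<omega> in Omega \<nu>. \<omega> i \<noteq> \<omega> j" if "i \<noteq> j" for i j
    using AE_distrD[OF measurable_two_coordinates, of "\<lambda>z. fst z \<noteq> snd z" i j]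
    unfolding distr_two_coordinates[OF that] by simp
  then show ?thesis
    unfolding AE_all_countable by (intro allI) (auto intro: AE_impI)
qed

lemma not_collision_distinct:
  assumes "\<forall>i j. i \<noteq> j \<longrightarrow> \<omega> i \<noteq> \<omega> j"
  shows "\<not> collision \<omega> s"
  using assms by (auto simp: collision_iff V_def)

lemma pred_coordinate_eq [measurable]:
  "Measurable.pred (Omega \<nu>) (\<lambda>\<omega>. \<omega> i = \<omega> j)" "Measurable.pred (Omega \<nu>) (\<lambda>\<omega>. \<omega> i = q)"
  unfolding pred_def by (intro borel_measurable_eq measurable_coordinate borel_measurable_const)+

lemma active_measurable [measurable]: "Measurable.pred (Omega \<nu>) (\<lambda>\<omega>. active \<omega> t)"
  unfolding active_def collision_iff V_def by measurable

lemma of_bool_measurable: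
  assumes "Measurable.pred M Q"
  shows "(\<lambda>x. of_bool (Q x) :: real) \<in> borel_measurable M"
  by (rule measurable_compose[OF assms]) simp

lemma integrable_active: "integrable (Omega \<nu>) (\<lambda>\<omega>. of_bool (active \<omega> t) :: real)"
  by (intro integrable_Omega_bounded[where C = 1] of_bool_measurable active_measurable) auto

text \<open>Whether round \<open>t\<close> is reached without collision is decided before \<open>V\<^sub>2\<^sub>t\<^sub>-\<^sub>1\<close> is drawn.\<close>

lemma sum_active_le:
  "measure \<nu> {q} * (\<Sum>t=1..T. \<integral>\<omega>. of_bool (active \<omega> t) \<partial>Omega \<nu>) \<le> 2"
proof -
  have int: "integrable (Omega \<nu>) (\<lambda>\<omega>. of_bool (active \<omega> t) * of_bool (\<omega> i = q) :: real)" for t i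
    by (intro integrable_Omega_bounded[where C = 1] borel_measurable_times of_bool_measurable
        active_measurable pred_coordinate_eq) auto
  have "(\<integral>\<omega>. of_bool (active \<omega> t) * of_bool (V \<omega> (2*t-1) = q) \<partial>Omega \<nu>) =
      (\<integral>\<omega>. of_bool (active \<omega> t) \<partial>Omega \<nu>) * measure \<nu> {q}" if "1 \<le> t" for t
  proof -
    have Q: "(\<lambda>x. of_bool (x = q) :: real) \<in> borel_measurable borel"
      by measurable
    have inner: "(\<integral>z. of_bool (fst z = q) * 1 \<partial>(\<nu> \<Otimes>\<^sub>M \<nu>)) = measure \<nu> {q}"
      using integral_pair_prod(1)[OF Q borel_measurable_const, of 1 1 1]
        integral_of_bool[of "{q}"] by (simp add: N.prob_space)
    \<comment> \<open>The second valuation of the round is ignored; it is present because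
      \<open>integral_fresh_pair\<close> draws both valuations at once.\<close>
    define h where "h \<omega> x y = (of_bool (active \<omega> t) * of_bool (x = q) :: real)"
      for \<omega> :: "nat \<Rightarrow> real" and x y :: real
    have "(\<integral>\<omega>. h \<omega> (\<omega> (2*t-1-1)) (\<omega> (2*t-1)) \<partial>Omega \<nu>) =
        (\<integral>\<omega>. (\<integral>z. h \<omega> (fst z) (snd z) \<partial>(\<nu> \<Otimes>\<^sub>M \<nu>)) \<partial>Omega \<nu>)"
    proof (rule integral_fresh_pair[where n = "2*(t-1)"])
      show "h \<omega> x y = h \<omega>' x y" if "\<And>k. k < 2*(t-1) \<Longrightarrow> \<omega> k = \<omega>' k" for \<omega> \<omega>' x y
        unfolding h_def using active_cong[of t \<omega> \<omega>'] that by simp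
      show "(\<lambda>z. h \<omega> (fst z) (snd z)) \<in> borel_measurable (\<nu> \<Otimes>\<^sub>M \<nu>)" for \<omega>
        unfolding h_def by measurable
      show "integrable (Omega \<nu>) (\<lambda>\<omega>. h \<omega> (\<omega> (2*t-1-1)) (\<omega> (2*t-1)))"
        unfolding h_def by (rule int)
    qed (use that in auto)
    then show ?thesis using inner by (simp add: h_def V_def)
  qed
  then have "measure \<nu> {q} * (\<Sum>t=1..T. \<integral>\<omega>. of_bool (active \<omega> t) \<partial>Omega \<nu>) =
      (\<Sum>t=1..T. \<integral>\<omega>. of_bool (active \<omega> t) * of_bool (V \<omega> (2*t-1) = q) \<partial>Omega \<nu>)"
    by (simp add: sum_distrib_left mult.commute)
  also have "\<dots> = (\<integral>\<omega>. (\<Sum>t=1..T. of_bool (active \<omega> t) * of_bool (V \<omega> (2*t-1) = q)) \<partial>Omega \<nu>)"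
    unfolding V_def by (intro integral_sum_real[symmetric] int)
  also have "\<dots> \<le> 2"
    unfolding V_def using active_repeats_le[unfolded V_def]
    by (intro O.integral_le_const Bochner_Integration.integrable_sum int AE_I2)
  finally show ?thesis .
qed

lemma P_FTM_measurable [measurable]: "(\<lambda>\<omega>. P_FTM \<omega> t) \<in> borel_measurable (Omega \<nu>)"
  unfolding P_FTM_def V_def by measurable

lemma P_FTM_unit:
  assumes "\<And>i. \<omega> i \<in> {0..1}"
  shows "P_FTM \<omega> t \<in> {0..1}"
proof (cases "t \<le> 1")
  case False
  define n where "n = 2*(t-1)"
  have "(\<Sum>i<n. \<omega> i) \<le> (\<Sum>i<n. 1)" "0 \<le> (\<Sum>i<n. \<omega> i)"
    using assms by (intro sum_mono sum_nonneg; simp)+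
  then have "(\<Sum>i<n. \<omega> i) / real n \<in> {0..1}"
    using False by (auto simp: n_def divide_le_eq)
  then show ?thesis using False by (simp only: P_FTM_eq n_def not_le Suc_le_eq numeral_2_eq_2 One_nat_def)
qed (simp add: P_FTM_def)

lemma P_FTM_dist_le_1:
  assumes "\<And>i. \<omega> i \<in> {0..1}"
  shows "\<bar>mean \<nu> - P_FTM \<omega> t\<bar> \<le> 1"
proof -
  have "P_FTM \<omega> t \<in> {0..1}" by (rule P_FTM_unit) fact
  then show ?thesis using mean_unit by (auto simp: abs_le_iff)
qed

lemma integrable_P_FTM:
  "integrable (Omega \<nu>) (\<lambda>\<omega>. \<bar>mean \<nu> - P_FTM \<omega> t\<bar>)"
  "integrable (Omega \<nu>) (\<lambda>\<omega>. (mean \<nu> - P_FTM \<omega> t)\<^sup>2)"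
proof -
  show "integrable (Omega \<nu>) (\<lambda>\<omega>. \<bar>mean \<nu> - P_FTM \<omega> t\<bar>)"
    using P_FTM_dist_le_1 by (intro integrable_Omega_bounded[where C = 1]) (simp_all del: atLeastAtMost_iff)
  show "integrable (Omega \<nu>) (\<lambda>\<omega>. (mean \<nu> - P_FTM \<omega> t)\<^sup>2)"
    using P_FTM_dist_le_1
    by (intro integrable_Omega_bounded[where C = 1]) (simp_all del: atLeastAtMost_iff add: abs_square_le_1)
qed

lemma P_FTM_square_error:
  assumes "2 \<le> t"
  shows "(\<integral>\<omega>. (mean \<nu> - P_FTM \<omega> t)\<^sup>2 \<partial>Omega \<nu>) \<le> 1 / (4 * real (2*(t-1)))"
  unfolding P_FTM_eq[OF assms] using assms by (intro sample_mean_square_error) auto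

lemma P_FTM_error:
  assumes "2 \<le> t"
  shows "(\<integral>\<omega>. \<bar>mean \<nu> - P_FTM \<omega> t\<bar> \<partial>Omega \<nu>) \<le> 1 / sqrt (real (2*(t-1)))"
proof -
  define r where "r = sqrt (real (2*(t-1)))"
  have r: "r > 0" "r * r = real (2*(t-1))" using assms by (auto simp: r_def)
  have "(\<integral>\<omega>. \<bar>mean \<nu> - P_FTM \<omega> t\<bar> \<partial>Omega \<nu>) \<le>
      (\<integral>\<omega>. r * (mean \<nu> - P_FTM \<omega> t)\<^sup>2 + 1 / (4 * r) \<partial>Omega \<nu>)"
  proof (intro integral_mono integrable_P_FTM Bochner_Integration.integrable_add integrable_mult_right)
    fix \<omega>
    define e where "e = \<bar>mean \<nu> - P_FTM \<omega> t\<bar>"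
    \<comment> \<open>The weight is tuned to an error \<open>e\<close> of size
      \<open>1 / (2 * r)\<close>, the root of the mean square bound.\<close>
    have "0 \<le> (2 * r * e - 1)\<^sup>2" by simp
    then have "e \<le> r * e\<^sup>2 + 1 / (4 * r)"
      using r by (simp add: field_simps power2_eq_square)
    then show "\<bar>mean \<nu> - P_FTM \<omega> t\<bar> \<le> r * (mean \<nu> - P_FTM \<omega> t)\<^sup>2 + 1 / (4 * r)"
      by (simp add: e_def)
  qed simp
  also have "\<dots> = r * (\<integral>\<omega>. (mean \<nu> - P_FTM \<omega> t)\<^sup>2 \<partial>Omega \<nu>) + 1 / (4 * r)"
    using integrable_P_FTM(2) by (simp add: O.prob_space)
  \<comment> \<open>The two terms are equal and add up to \<open>1 / (2 * r)\<close>; the final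
    bound \<open>1 / r\<close> is a rounding.\<close>
  also have "\<dots> \<le> r * (1 / (4 * (r * r))) + 1 / (4 * r)"
    unfolding r(2) using r(1) P_FTM_square_error[OF assms]
    by (intro add_right_mono mult_left_mono) auto
  also have "\<dots> \<le> 1 / r"
    using r(1) by (simp add: field_simps)
  finally show ?thesis by (simp add: r_def)
qed

lemma integrable_expected_gft:
  assumes [measurable]: "P \<in> borel_measurable (Omega \<nu>)"
  shows "integrable (Omega \<nu>) (\<lambda>\<omega>. expected_gft (P \<omega>))"
  using expected_gft_nonneg expected_gft_le_1
  by (intro integrable_Omega_bounded[where C = 1]) auto

lemma expected_gft_le_SUP:
  assumes "q \<in> {0..1}" shows "expected_gft q \<le> (SUP q\<in>{0..1}. expected_gft q)"
  using assms expected_gft_le_1 by (intro cSUP_upper) (auto intro!: bdd_aboveI[where M = 1])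

lemma expected_gft_gap_le:
  assumes "q \<in> {0..1}"
  shows "expected_gft q - expected_gft p \<le> 2 * measure \<nu> {q} + 2 * \<bar>mean \<nu> - p\<bar>"
proof -
  have "\<bar>mean \<nu> - p\<bar> * measure \<nu> {min (mean \<nu>) p<..max (mean \<nu>) p} \<le> \<bar>mean \<nu> - p\<bar> * 1"
    by (intro mult_left_mono) auto
  then show ?thesis using expected_gft_gap[OF assms, of p] by simp
qed

end

section \<open>The two regret bounds\<close>

context rho_selection
begin

lemma P_FTrho_measurable [measurable]: "(\<lambda>\<omega>. P_FTrho sel \<omega> t) \<in> borel_measurable (Omega \<nu>)"
proof (cases "2 \<le> t")
  case True
  then show ?thesis using sel_measurable by (simp add: P_FTrho_eq)
qed (simp add: P_FTrho_def)

lemma price_measurable [measurable]: "(\<lambda>\<omega>. P_FTMTrho sel \<omega> t) \<in> borel_measurable (Omega \<nu>)"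
  unfolding P_FTMTrho_def tau_ge_iff by measurable

lemma price_cong:
  assumes "\<And>k. k < 2 * (t - 1) \<Longrightarrow> \<omega> k = \<omega>' k"
  shows "P_FTMTrho sel \<omega> t = P_FTMTrho sel \<omega>' t"
proof (cases "2 \<le> t")
  case True
  have "map \<omega> [0..<2*(t-1)] = map \<omega>' [0..<2*(t-1)]" "(\<Sum>i<2*(t-1). \<omega> i) = (\<Sum>i<2*(t-1). \<omega>' i)"
    using assms by (auto intro!: sum.cong)
  then show ?thesis
    unfolding P_FTMTrho_def tau_ge_iff P_FTM_eq[OF True] P_FTrho_eq[OF True]
    by (simp only: active_cong[OF assms])
qed (simp add: P_FTMTrho_def P_FTM_def P_FTrho_def)

lemma integral_GFT_price:
  assumes "1 \<le> t"
  shows "(\<integral>\<omega>. GFT \<omega> t (P_FTMTrho sel \<omega> t) \<partial>Omega \<nu>) =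
    (\<integral>\<omega>. expected_gft (P_FTMTrho sel \<omega> t) \<partial>Omega \<nu>)"
  unfolding GFT_def V_def
proof (rule integral_gft_price[where n = "2*(t-1)"])
  show "P_FTMTrho sel \<omega> t = P_FTMTrho sel \<omega>' t" if "\<And>k. k < 2 * (t - 1) \<Longrightarrow> \<omega> k = \<omega>' k" for \<omega> \<omega>'
    using that by (rule price_cong)
qed (use assms in auto)

text \<open>The posted price depends on earlier rounds only, so both expectations in the regret are
  sums of \<open>expected_gft\<close>. It then suffices to bound the loss against each fixed price,
  with one constant for all.\<close>

lemma regret_le:
  assumes "\<And>q. q \<in> {0..1} \<Longrightarrow>
    (\<Sum>t=1..T. expected_gft q - (\<integral>\<omega>. expected_gft (P_FTMTrho sel \<omega> t) \<partial>Omega \<nu>)) \<le> C"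
  shows "regret \<nu> sel T \<le> C"
proof -
  have alg: "(\<integral>\<omega>. (\<Sum>t=1..T. GFT \<omega> t (P_FTMTrho sel \<omega> t)) \<partial>Omega \<nu>) =
    (\<Sum>t=1..T. \<integral>\<omega>. expected_gft (P_FTMTrho sel \<omega> t) \<partial>Omega \<nu>)" (is "_ = ?alg")
  proof (subst integral_sum_real)
    show "integrable (Omega \<nu>) (\<lambda>\<omega>. GFT \<omega> t (P_FTMTrho sel \<omega> t))" for t
      unfolding GFT_def V_def by (intro integrable_gft_price price_measurable)
  qed (auto intro!: sum.cong integral_GFT_price)
  have fix_price: "(\<integral>\<omega>. (\<Sum>t=1..T. GFT \<omega> t q) \<partial>Omega \<nu>) = (\<Sum>t=1..T. expected_gft q)" for q
  proof (subst integral_sum_real)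
    show "integrable (Omega \<nu>) (\<lambda>\<omega>. GFT \<omega> t q)" for t
      unfolding GFT_def V_def by (intro integrable_gft_price) simp
    show "(\<Sum>t=1..T. \<integral>\<omega>. GFT \<omega> t q \<partial>Omega \<nu>) = (\<Sum>t=1..T. expected_gft q)"
      unfolding GFT_def V_def by (intro sum.cong integral_gft_coordinates refl) auto
  qed
  have "(SUP q\<in>{0..1}. \<integral>\<omega>. (\<Sum>t=1..T. GFT \<omega> t q) \<partial>Omega \<nu>) \<le> C + ?alg"
  proof (rule cSUP_least)
    fix q :: real assume "q \<in> {0..1}"
    from assms[OF this] show "(\<integral>\<omega>. (\<Sum>t=1..T. GFT \<omega> t q) \<partial>Omega \<nu>) \<le> C + ?alg"
      unfolding fix_price by (simp only: sum_subtractf)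
  qed simp
  then show ?thesis unfolding regret_def alg by linarith
qed

lemma regret_bounded_density:
  assumes M: "0 < M" "density_bounded_by \<nu> M" and T: "2 \<le> T"
  shows "regret \<nu> sel T \<le> 1/2 + M/4 * (1 + ln (real T - 1))"
proof (rule regret_le)
  fix q :: real assume q: "q \<in> {0..1}"
  let ?r = "\<lambda>t. expected_gft q - (\<integral>\<omega>. expected_gft (P_FTMTrho sel \<omega> t) \<partial>Omega \<nu>)"
  note atomless = density_bounded_atomless[OF M(2) less_imp_le[OF M(1)]]
  have round: "?r t \<le> M / 4 * (1 / real (t - 1))" if t: "2 \<le> t" for t
  proof -
    have "?r t = (\<integral>\<omega>. expected_gft q - expected_gft (P_FTMTrho sel \<omega> t) \<partial>Omega \<nu>)"
      by (simp add: integrable_expected_gft O.prob_space)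
    also have "\<dots> \<le> (\<integral>\<omega>. 2 * M * (mean \<nu> - P_FTM \<omega> t)\<^sup>2 \<partial>Omega \<nu>)"
    proof (intro integral_mono_AE integrable_mult_right integrable_P_FTM
        Bochner_Integration.integrable_diff integrable_expected_gft price_measurable)
      show "AE \<omega> in Omega \<nu>. expected_gft q - expected_gft (P_FTMTrho sel \<omega> t) \<le>
          2 * M * (mean \<nu> - P_FTM \<omega> t)\<^sup>2"
        using AE_distinct[OF atomless]
      proof eventually_elim
        case (elim \<omega>)
        then have P: "P_FTMTrho sel \<omega> t = P_FTM \<omega> t"
          using not_collision_distinct by (simp add: P_FTMTrho_def tau_ge_iff active_def)
        define e where "e = \<bar>mean \<nu> - P_FTM \<omega> t\<bar>"
        \<comment> \<open>The atom term vanishes, and the interval between mean and price has mass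
          at most \<open>M * e\<close>.\<close>
        have "expected_gft q - expected_gft (P_FTM \<omega> t) \<le> 2 * e * (M * e)"
          unfolding e_def
          by (rule order_trans[OF expected_gft_gap[OF q]])
            (use M in \<open>auto simp: atomless intro!: mult_left_mono density_bounded_interval\<close>)
        also have "\<dots> = 2 * M * (mean \<nu> - P_FTM \<omega> t)\<^sup>2"
          by (simp add: e_def power2_eq_square)
        finally show ?case by (simp add: P)
      qed
    qed simp
    also have "\<dots> = 2 * M * (\<integral>\<omega>. (mean \<nu> - P_FTM \<omega> t)\<^sup>2 \<partial>Omega \<nu>)"
      by simp
    \<comment> \<open>The sample mean uses \<open>2 * (t - 1)\<close> valuations, so its mean square
      error is at most \<open>1 / (8 * (t - 1))\<close>; this is the source of
      \<open>M / 4\<close>.\<close>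
    also have "\<dots> \<le> 2 * M * (1 / (4 * real (2*(t-1))))"
      using M by (intro mult_left_mono P_FTM_square_error t) auto
    also have "\<dots> = M / 4 * (1 / real (t - 1))" by simp
    finally show ?thesis .
  qed
  have "(\<Sum>t=1..T. ?r t) = ?r 1 + (\<Sum>t=2..T. ?r t)"
    using T by (intro sum_head_2) simp
  also have "\<dots> \<le> 1/2 + (\<Sum>t=2..T. M / 4 * (1 / real (t - 1)))"
  proof (intro add_mono sum_mono round)
    have "0 \<le> (\<integral>\<omega>. expected_gft (P_FTMTrho sel \<omega> 1) \<partial>Omega \<nu>)"
      by (intro integral_nonneg_AE AE_I2 expected_gft_nonneg)
    then show "?r 1 \<le> 1/2" using expected_gft_le_half[of q] by linarith
  qed simp
  also have "(\<Sum>t=2..T. M / 4 * (1 / real (t - 1))) = M / 4 * (\<Sum>k=1..T - 1. 1 / real k)"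
    unfolding sum_distrib_left by (rule sum_shift_2)
  also have "\<dots> \<le> M / 4 * (1 + ln (real T - 1))"
    using harmonic_le[of "T - 2"] T M
    by (intro mult_left_mono) (auto simp: Suc_diff_Suc numeral_2_eq_2 of_nat_diff)
  finally show "(\<Sum>t=1..T. ?r t) \<le> 1/2 + M/4 * (1 + ln (real T - 1))" by simp
qed

text \<open>The constant is 16 from \<open>expected_gft_sel\<close> plus 1 for the diagonal loss, as
  \<open>1 / n \<le> 1 / sqrt n\<close>. Comparing with the supremum instead of a fixed price keeps
  the integrand nonnegative almost surely, so that it can also be charged in rounds where this price
  is not posted.\<close>

lemma expected_gft_FTrho_gap:
  assumes t: "2 \<le> t"
  shows "(\<integral>\<omega>. (SUP q\<in>{0..1}. expected_gft q) - expected_gft (P_FTrho sel \<omega> t) \<partial>Omega \<nu>) \<le>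
      17 / sqrt (real (2*(t-1)))"
proof -
  define n where "n = 2 * (t - 1)"
  define E where "E = (\<integral>\<omega>. expected_gft (P_FTrho sel \<omega> t) \<partial>Omega \<nu>)"
  have n: "0 < n" using t by (simp add: n_def)
  have "sqrt n * 1 \<le> sqrt n * sqrt n"
    using n by (intro mult_left_mono) auto
  then have inv: "1 / n \<le> 1 / sqrt n"
    using n by (intro divide_left_mono) auto
  have "(SUP q\<in>{0..1}. expected_gft q) \<le> 17 / sqrt n + E"
  proof (rule cSUP_least)
    fix q :: real assume q: "q \<in> {0..1}"
    have "(1 - 1 / n) * expected_gft q - 16 / sqrt n \<le> E"
      using expected_gft_sel[OF n q] by (simp add: E_def P_FTrho_eq[OF t] n_def)
    moreover have "1 / n * expected_gft q \<le> 1 / n * 1"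
      using expected_gft_le_1 by (intro mult_left_mono) auto
    ultimately show "expected_gft q \<le> 17 / sqrt n + E"
      using inv by (simp add: algebra_simps)
  qed simp
  then show ?thesis
    by (simp add: integrable_expected_gft O.prob_space E_def n_def)
qed

lemma regret_sqrt:
  assumes T: "1 \<le> T"
  shows "regret \<nu> sel T \<le> 15/2 + 6 * (2 * sqrt pi + sqrt 2) * sqrt (real T - 1)"
proof (rule regret_le)
  fix q :: real assume q: "q \<in> {0..1}"
  let ?r = "\<lambda>t. expected_gft q - (\<integral>\<omega>. expected_gft (P_FTMTrho sel \<omega> t) \<partial>Omega \<nu>)"
  let ?a = "\<lambda>t. \<integral>\<omega>. of_bool (active \<omega> t) \<partial>Omega \<nu> :: real"
  let ?best = "SUP q\<in>{0..1}. expected_gft q"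
  have r: "?r t = (\<integral>\<omega>. expected_gft q - expected_gft (P_FTMTrho sel \<omega> t) \<partial>Omega \<nu>)" for t
    by (simp add: integrable_expected_gft O.prob_space)
  \<comment> \<open>The price 1/2 is within 1/2 of the mean, which gives the summand 1. The factor
    \<open>?a 1\<close>, equal to 1, lets the atom term join the sum over all active rounds.\<close>
  have round1: "?r 1 \<le> 2 * measure \<nu> {q} * ?a 1 + 1"
  proof -
    have "P_FTMTrho sel \<omega> 1 = 1/2" for \<omega>
      by (simp add: P_FTMTrho_def P_FTM_def P_FTrho_def)
    then have "(\<integral>\<omega>. expected_gft (P_FTMTrho sel \<omega> 1) \<partial>Omega \<nu>) = expected_gft (1/2)"
      by (simp only:) simp
    moreover have "?a 1 = 1"
      by (simp add: active_def)
    ultimately show ?thesis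
      using expected_gft_gap_le[OF q, of "1/2"] mean_unit
      by (simp only:) (simp add: abs_if split: if_splits)
  qed
  have round: "?r t \<le> 2 * measure \<nu> {q} * ?a t + 19 / sqrt 2 * (1 / sqrt (real (t - 1)))"
    if t: "2 \<le> t" for t
  proof -
    \<comment> \<open>In an active round the first two terms bound the loss, afterwards the last one
      does. In either case the remaining terms are nonnegative on paths in the unit interval, so no
      case distinction survives the integration.\<close>
    have "?r t \<le> (\<integral>\<omega>. 2 * measure \<nu> {q} * of_bool (active \<omega> t) + 2 * \<bar>mean \<nu> - P_FTM \<omega> t\<bar>
        + (?best - expected_gft (P_FTrho sel \<omega> t)) \<partial>Omega \<nu>)"
      unfolding r
    proof (intro integral_mono_AE integrable_mult_right integrable_P_FTM integrable_active
        Bochner_Integration.integrable_diff Bochner_Integration.integrable_add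
        integrable_expected_gft price_measurable P_FTrho_measurable)
      show "AE \<omega> in Omega \<nu>. expected_gft q - expected_gft (P_FTMTrho sel \<omega> t) \<le>
         2 * measure \<nu> {q} * of_bool (active \<omega> t) + 2 * \<bar>mean \<nu> - P_FTM \<omega> t\<bar>
         + (?best - expected_gft (P_FTrho sel \<omega> t))"
        using AE_Omega_unit
      proof eventually_elim
        case (elim \<omega>)
        then have "P_FTrho sel \<omega> t \<in> {0..1}"
          unfolding P_FTrho_eq[OF t] using t by (intro sel_emp_gft(1)) auto
        then have "expected_gft (P_FTrho sel \<omega> t) \<le> ?best" "expected_gft q \<le> ?best"
          using q by (auto intro!: expected_gft_le_SUP simp del: atLeastAtMost_iff)
        then show ?case
        proof (cases "active \<omega> t")
          case True
          then show ?thesis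
            using expected_gft_gap_le[OF q, of "P_FTM \<omega> t"] \<open>expected_gft (P_FTrho sel \<omega> t) \<le> ?best\<close>
            by (simp add: P_FTMTrho_def tau_ge_iff)
        next
          case False
          then show ?thesis
            using \<open>expected_gft q \<le> ?best\<close>
            by (simp add: P_FTMTrho_def tau_ge_iff add_increasing)
        qed
      qed
    qed simp_all
    also have "\<dots> = 2 * measure \<nu> {q} * ?a t + 2 * (\<integral>\<omega>. \<bar>mean \<nu> - P_FTM \<omega> t\<bar> \<partial>Omega \<nu>)
        + (\<integral>\<omega>. ?best - expected_gft (P_FTrho sel \<omega> t) \<partial>Omega \<nu>)"
      by (simp add: integrable_P_FTM integrable_active integrable_expected_gft)
    also have "\<dots> \<le> 2 * measure \<nu> {q} * ?a t + 2 * (1 / sqrt (real (2*(t-1))))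
        + 17 / sqrt (real (2*(t-1)))"
      by (intro add_mono mult_left_mono P_FTM_error expected_gft_FTrho_gap t) auto
    \<comment> \<open>The 19 collects 2 from the sample mean and 17 from the maximiser.\<close>
    also have "\<dots> = 2 * measure \<nu> {q} * ?a t + 19 / sqrt 2 * (1 / sqrt (real (t - 1)))"
      by (simp add: real_sqrt_mult)
    finally show ?thesis .
  qed
  have "(\<Sum>t=1..T. ?r t) = ?r 1 + (\<Sum>t=2..T. ?r t)"
    using T by (intro sum_head_2) simp
  also have "\<dots> \<le> (2 * measure \<nu> {q} * ?a 1 + 1) +
      (\<Sum>t=2..T. 2 * measure \<nu> {q} * ?a t + 19 / sqrt 2 * (1 / sqrt (real (t - 1))))"
    by (intro add_mono sum_mono round round1) simp
  also have "\<dots> = 2 * (measure \<nu> {q} * (\<Sum>t=1..T. ?a t)) + 1 +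
      19 / sqrt 2 * (\<Sum>k=1..T - 1. 1 / sqrt (real k))"
    unfolding sum_shift_2[symmetric] sum_head_2[OF T]
    by (simp add: sum.distrib sum_distrib_left algebra_simps)
  also have "\<dots> \<le> 2 * 2 + 1 + 19 / sqrt 2 * (2 * sqrt (real (T - 1)))"
    by (intro add_mono mult_left_mono sum_active_le sum_inverse_sqrt_le) auto
  also have "\<dots> = 5 + 19 * sqrt 2 * sqrt (real T - 1)"
    using T by (simp add: of_nat_diff field_simps)
  \<comment> \<open>The constants compare because \<open>13 * sqrt 2 \<le> 12 * sqrt pi\<close>:
    squared, this is \<open>338 \<le> 144 * pi\<close>, which follows from
    \<open>pi > 3\<close>.\<close>
  also have "\<dots> \<le> 15/2 + 6 * (2 * sqrt pi + sqrt 2) * sqrt (real T - 1)"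
  proof (intro add_mono mult_right_mono)
    have "(13 * sqrt 2)\<^sup>2 \<le> (12 * sqrt pi)\<^sup>2"
      using pi_gt3 by (simp add: power_mult_distrib)
    then have "13 * sqrt 2 \<le> 12 * sqrt pi"
      by (rule power2_le_imp_le) simp
    then show "19 * sqrt 2 \<le> 6 * (2 * sqrt pi + sqrt 2)" by simp
  qed (use T in auto)
  finally show "(\<Sum>t=1..T. ?r t) \<le> 15/2 + 6 * (2 * sqrt pi + sqrt 2) * sqrt (real T - 1)" .
qed

end

theorem theorem5p2:
  fixes \<nu> :: "real measure" and sel :: "real list \<Rightarrow> real"
  assumes "prob_space \<nu>" and "sets \<nu> = sets borel" and "measure \<nu> {0..1} = 1"
    and sel_argmax: "\<forall>xs. xs \<noteq> [] \<and> set xs \<subseteq> {0..1} \<longrightarrow>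
          sel xs \<in> {0..1} \<and> (\<forall>p\<in>{0..1}. rho (emp xs) p \<le> rho (emp xs) (sel xs))"
    and sel_meas: "\<forall>n. (\<lambda>\<omega>. sel (map \<omega> [0..<n])) \<in> borel_measurable (Omega \<nu>)"
  shows "(\<forall>M>0. density_bounded_by \<nu> M \<longrightarrow>
            (\<forall>T\<ge>2. regret \<nu> sel T \<le> 1/2 + M/4 * (1 + ln (real T - 1))))
       \<and> (\<not> (\<exists>M>0. density_bounded_by \<nu> M) \<longrightarrow>
            (\<forall>T\<ge>1. regret \<nu> sel T \<le> 15/2 + 6 * (2 * sqrt pi + sqrt 2) * sqrt (real T - 1)))"
proof -
  interpret rho_selection \<nu> sel
  proof (intro rho_selection.intro iid_valuations.intro rho_selection_axioms.intro)
    show "prob_space \<nu>" "sets \<nu> = sets borel" "measure \<nu> {0..1} = 1" by fact+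
    show "sel xs \<in> {0..1} \<and> (\<forall>p\<in>{0..1}. rho (emp xs) p \<le> rho (emp xs) (sel xs))"
      if "xs \<noteq> []" "set xs \<subseteq> {0..1}" for xs
      using sel_argmax that by blast
    show "(\<lambda>\<omega>. sel (map \<omega> [0..<n])) \<in> borel_measurable (Omega \<nu>)" for n using sel_meas by blast
  qed
  show ?thesis using regret_bounded_density regret_sqrt by blast
qed

end
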